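(* Let $F$ be a free group with a fixed free basis, and let $g\in F$. (1) $\bigcap_{\ell=1}^{\infty}\langle g\rangle_{\ell}^{F}=\langle g\rangle$. (2) Let $D(g,\ell)$ denote the minimum of the lengths (with respect to the fixed free basis) of the elements of $\langle g\rangle_{\ell}^{F}\setminus\langle g\rangle$. Then there is a constant $c>0$ such that $D(g,\ell)\ge c\,2^{\ell}$ for every $\ell\ge 1$.
   Context: For an element $g$ of a group $G$, the $\ell$-subnormal closure $\langle g\rangle_{\ell}^{G}$ is defined by induction on $\ell\ge1$: $\langle g\rangle_1^{G}$ is the normal closure of $g$ in $G$ (the smallest normal subgroup of $G$ containing $g$), and for $\ell\ge 2$, $\langle g\rangle_{\ell}^{G}$ is the normal closure of $g$ in the group $\langle g\rangle_{\ell-1}^{G}$. $\langle g\rangle$ is the cyclic subgroup generated by $g$. The length of an element of a free group is the length of the reduced word in the free basis representing it. The constant $c$ may depend on $g$ but not on $\ell$. The minimum over the empty set is understood as $+\infty$. *)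

theory Defs
  imports "HOL-Algebra.Algebra" "HOL-Library.Extended_Real"
begin

section \<open>Free groups and the length of an element\<close>

text \<open>
  A letter \<open>(x, True)\<close> stands for \<open>x\<close> and \<open>(x, False)\<close> for the formal inverse of \<open>x\<close>.
\<close>

definition reduced_words :: "'a set \<Rightarrow> ('a \<times> bool) list set" where
  "reduced_words S =
     {w. fst ` set w \<subseteq> S \<and> successively (\<lambda>u v. \<not> (fst u = fst v \<and> snd u \<noteq> snd v)) w}"

primrec word_eval :: "('a, 'b) monoid_scheme \<Rightarrow> ('a \<times> bool) list \<Rightarrow> 'a" where
  "word_eval G [] = \<one>\<^bsub>G\<^esub>"
| "word_eval G (u # w) = (if snd u then fst u else inv\<^bsub>G\<^esub> (fst u)) \<otimes>\<^bsub>G\<^esub> word_eval G w"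

definition free_basis :: "('a, 'b) monoid_scheme \<Rightarrow> 'a set \<Rightarrow> bool" where
  "free_basis G S \<longleftrightarrow>
     S \<subseteq> carrier G \<and> bij_betw (word_eval G) (reduced_words S) (carrier G)"

definition word_length :: "('a, 'b) monoid_scheme \<Rightarrow> 'a set \<Rightarrow> 'a \<Rightarrow> nat" where
  "word_length G S x = length (THE w. w \<in> reduced_words S \<and> word_eval G w = x)"


section \<open>Subnormal closures\<close>

definition normal_closure :: "('a, 'b) monoid_scheme \<Rightarrow> 'a \<Rightarrow> 'a set" where
  "normal_closure G g = \<Inter> {N. N \<lhd> G \<and> g \<in> N}"

text \<open>
  The recursion starts at level \<open>0\<close> with the whole group, so that level \<open>1\<close> is the normal
  closure of \<open>g\<close> in \<open>G\<close>.
\<close>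

primrec subnormal_closure :: "('a, 'b) monoid_scheme \<Rightarrow> 'a \<Rightarrow> nat \<Rightarrow> 'a set" where
  "subnormal_closure G g 0 = carrier G"
| "subnormal_closure G g (Suc l) = normal_closure (G\<lparr>carrier := subnormal_closure G g l\<rparr>) g"

lemma (in group) normal_closure_normal:
  assumes "g \<in> carrier G"
  shows "normal_closure G g \<lhd> G"
proof -
  have G: "carrier G \<lhd> G"
    using normal_inv_iff subgroup_self by blast
  have "subgroup (normal_closure G g) G"
    unfolding normal_closure_def
    by (rule subgroups_Inter) (use G assms normal_imp_subgroup in auto)
  moreover have "x \<otimes> h \<otimes> inv x \<in> normal_closure G g"
    if "x \<in> carrier G" "h \<in> normal_closure G g" for x h
    using that normal.inv_op_closed2 unfolding normal_closure_def by fastforce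
  ultimately show ?thesis
    by (simp add: normal_inv_iff)
qed

lemma mem_normal_closure: "g \<in> normal_closure G g"
  by (simp add: normal_closure_def)

lemma normal_closure_least: "N \<lhd> G \<Longrightarrow> g \<in> N \<Longrightarrow> normal_closure G g \<subseteq> N"
  by (auto simp: normal_closure_def)

lemma (in group) subnormal_closure_1: "subnormal_closure G g 1 = normal_closure G g"
  by simp

lemma (in group) subnormal_closure_subgroup:
  assumes "g \<in> carrier G"
  shows "subgroup (subnormal_closure G g l) G \<and> g \<in> subnormal_closure G g l"
proof (induction l)
  case 0
  then show ?case using assms subgroup_self by simp
next
  case (Suc l)
  let ?H = "G\<lparr>carrier := subnormal_closure G g l\<rparr>"
  have "group ?H"
    using Suc subgroup_imp_group by blast
  then have "normal_closure ?H g \<lhd> ?H"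
    using Suc by (intro group.normal_closure_normal) auto
  then have "subgroup (normal_closure ?H g) G"
    using Suc incl_subgroup normal_imp_subgroup by blast
  then show ?case
    using mem_normal_closure by simp
qed


section \<open>The depth function\<close>

text \<open>
  In \<^typ>\<open>enat\<close> the infimum of a nonempty set is its minimum, and the infimum of the empty set
  is \<open>\<infinity>\<close>.
\<close>

definition min_length :: "('a, 'b) monoid_scheme \<Rightarrow> 'a set \<Rightarrow> 'a \<Rightarrow> nat \<Rightarrow> enat" where
  "min_length G S g l =
     (INF x \<in> subnormal_closure G g l - generate G {g}. enat (word_length G S x))"

end

theory Submission
  imports Defs "HOL-Library.Function_Algebras"
begin

text \<open>
  Write \<open>H\<^sub>l\<close> for the \<open>l\<close>-th subnormal closure of \<open>g\<close> and \<open>|x|\<close> for the length of \<open>x\<close>. The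
  exponential lower bound comes from a doubling argument, which is started by residual
  nilpotence. The intersection statement is then immediate: an element of all \<open>H\<^sub>l\<close> outside
  \<open>\<langle>g\<rangle>\<close> would have length at least \<open>c 2\<^sup>l\<close> for every \<open>l\<close>.

  \<^emph>\<open>Doubling.\<close> Suppose that all elements of \<open>H = H\<^sub>l\<close> outside \<open>\<langle>g\<rangle>\<close> have length at least
  \<open>D \<ge> 2|g| + 2\<close>. In the graph whose vertices are the right cosets of \<open>H\<close> and whose edges join
  \<open>Hx\<close> to \<open>Hxs\<close> for each basis element \<open>s\<close>, the word of \<open>g\<close> is a closed path at \<open>H\<close>; call its
  edges the loop edges. Reading off the other edges along a path gives a homomorphism from \<open>H\<close>
  to the free group on these edges. It kills \<open>g\<close>, and therefore all of \<open>H\<^sub>l\<^sub>+\<^sub>1\<close>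
  (\<open>normal_closure_trace_trivial\<close>). Let \<open>x\<close> lie in \<open>H\<^sub>l\<^sub>+\<^sub>1\<close> but not in \<open>\<langle>g\<rangle>\<close>. If its path used
  loop edges only, then \<open>x\<close> would be a product of elements of \<open>H\<close> of length at most
  \<open>2|g| + 1\<close>, one for each letter, and so a power of \<open>g\<close> (\<open>path_in_loop_power\<close>). Hence the
  sequence of other edges is nonempty, and since it reduces to the empty word, the path of \<open>x\<close> is
  \<open>\<alpha> e \<gamma> e\<^sup>-\<^sup>1 \<beta>\<close> with \<open>e\<close> not a loop edge and \<open>\<gamma>\<close> a nontrivial closed path of loop edges. So \<open>\<alpha> e\<close>
  ends on the loop, and closing it by an initial segment of the word of \<open>g\<close>, traversed backwards,
  gives an element of \<open>H\<close>. That element is not in \<open>\<langle>g\<rangle>\<close>, because the edge \<open>e\<close> survives in its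
  reduced path (\<open>escaping_path_long\<close>). Thus \<open>|\<alpha>| + 1 + |g| \<ge> D\<close>, the same holds for \<open>\<beta>\<close>, and
  \<open>|x| - 2|g| \<ge> 2 (D - 2|g|)\<close> (\<open>normal_closure_deeper\<close>).

  \<^emph>\<open>Start.\<close> For some \<open>l\<close> all elements of \<open>H\<^sub>l\<close> of length at most \<open>2|g| + 1\<close> are powers of \<open>g\<close>
  (\<open>short_element_cyclic\<close>). In the Magnus representation a basis element \<open>s\<close> acts as
  multiplication by \<open>1 + s\<close> on noncommutative power series. Calling two group elements congruent
  in degree \<open>n\<close> if their actions differ by an operator that raises degrees by \<open>n\<close>, one sees
  by induction that every element of \<open>H\<^sub>l\<close> is congruent in degree \<open>l + 1\<close> to a power \<open>g\<^sup>k\<close>, since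
  commutation with an arbitrary element gains one degree (\<open>subnormal_closure_cong_power\<close>). A
  leading coefficient of \<open>g\<close> recovers \<open>k\<close> linearly, so \<open>k\<close> is bounded in terms of \<open>|x|\<close>
  (\<open>leading_coefficient\<close>, \<open>magnus_bounded_by_length\<close>). Then \<open>x g\<^sup>-\<^sup>k\<close> has bounded length and is
  congruent to \<open>1\<close> in a degree that grows with \<open>l\<close>, which by the faithfulness of the Magnus
  representation forces it to be \<open>1\<close> (\<open>cong_deg_one_short\<close>).
\<close>

section \<open>Free reduction of words\<close>

definition flip :: "'c \<times> bool \<Rightarrow> 'c \<times> bool" where
  "flip u = (fst u, \<not> snd u)"

definition reduced :: "('c \<times> bool) list \<Rightarrow> bool" where
  "reduced = successively (\<lambda>u v. v \<noteq> flip u)"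

definition inverse_word :: "('c \<times> bool) list \<Rightarrow> ('c \<times> bool) list" where
  "inverse_word w = rev (map flip w)"

fun cancel_cons :: "'c \<times> bool \<Rightarrow> ('c \<times> bool) list \<Rightarrow> ('c \<times> bool) list" where
  "cancel_cons u [] = [u]"
| "cancel_cons u (v # w) = (if v = flip u then w else u # v # w)"

definition free_reduce :: "('c \<times> bool) list \<Rightarrow> ('c \<times> bool) list" where
  "free_reduce w = foldr cancel_cons w []"

lemma flip_simps [simp]:
  "fst (flip u) = fst u" "snd (flip u) = (\<not> snd u)" "flip (flip u) = u" "flip u \<noteq> u"
  by (auto simp: flip_def prod_eq_iff)

lemma eq_flip_iff: "v = flip u \<longleftrightarrow> fst u = fst v \<and> snd u \<noteq> snd v"
  by (auto simp: flip_def prod_eq_iff)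

lemma free_reduce_simps [simp]:
  "free_reduce [] = []" "free_reduce (u # w) = cancel_cons u (free_reduce w)"
  by (simp_all add: free_reduce_def)

lemma reduced_words_eq: "reduced_words S = {w. fst ` set w \<subseteq> S \<and> reduced w}"
  by (simp add: reduced_words_def reduced_def eq_flip_iff)

lemma reduced_Nil [simp]: "reduced []"
  by (simp add: reduced_def)

lemma reduced_Cons: "reduced (u # w) \<longleftrightarrow> reduced w \<and> (w = [] \<or> hd w \<noteq> flip u)"
  by (auto simp: reduced_def successively_Cons)

lemma reduced_append:
  "reduced (v @ w) \<longleftrightarrow> reduced v \<and> reduced w \<and> (v = [] \<or> w = [] \<or> hd w \<noteq> flip (last v))"
  by (auto simp: reduced_def successively_append_iff)

lemma reduced_cancel_cons: "reduced w \<Longrightarrow> reduced (cancel_cons u w)"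
  by (cases w) (auto simp: reduced_Cons)

lemma reduced_free_reduce: "reduced (free_reduce w)"
  by (induction w) (auto intro: reduced_cancel_cons)

lemma free_reduce_reduced: "reduced w \<Longrightarrow> free_reduce w = w"
proof (induction w)
  case (Cons u w)
  then show ?case by (cases w) (auto simp: reduced_Cons)
qed simp

lemma cancel_cons_flip: "reduced w \<Longrightarrow> cancel_cons u (cancel_cons (flip u) w) = w"
  by (cases w; cases "tl w") (auto simp: reduced_Cons)

lemma free_reduce_append_cong:
  "free_reduce b = free_reduce c \<Longrightarrow> free_reduce (a @ b) = free_reduce (a @ c)"
  by (induction a) auto

lemma foldr_cancel_cons_cancel_cons:
  assumes "reduced b"
  shows "foldr cancel_cons (cancel_cons u a) b = cancel_cons u (foldr cancel_cons a b)"
proof (cases a)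
  case (Cons v a')
  have "reduced (foldr cancel_cons a' b)"
    using assms by (induction a') (auto intro: reduced_cancel_cons)
  then show ?thesis using Cons by (auto simp: cancel_cons_flip)
qed simp

text \<open>
  Together with \<open>free_reduce_append_cong\<close> this makes having the same reduced form a congruence for
  concatenation, so that \<open>free_reduce\<close> decides equality in the free group on any set of letters. It
  will be applied both to words and to sequences of edges.
\<close>
lemma free_reduce_append_left: "free_reduce (free_reduce a @ b) = free_reduce (a @ b)"
proof (induction a)
  case (Cons u a)
  have "free_reduce (c @ b) = foldr cancel_cons c (free_reduce b)" for c
    by (simp add: free_reduce_def)
  with Cons show ?case
    using foldr_cancel_cons_cancel_cons[OF reduced_free_reduce] by (metis append_Cons free_reduce_simps(2))
qed simp

lemma free_reduce_trivial_prefix: "free_reduce a = [] \<Longrightarrow> free_reduce (a @ b) = free_reduce b"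
  using free_reduce_append_left[of a b] by simp

lemma set_cancel_cons: "set (cancel_cons u w) \<subseteq> insert u (set w)"
  by (cases w) auto

lemma set_free_reduce: "set (free_reduce w) \<subseteq> set w"
  by (induction w) (use set_cancel_cons in fastforce)+

lemma length_cancel_cons: "length (cancel_cons u w) \<le> Suc (length w)"
  by (cases w) auto

lemma length_free_reduce: "length (free_reduce w) \<le> length w"
  by (induction w) (auto intro: order.trans[OF length_cancel_cons])

lemma reduced_inverse_word: "reduced w \<Longrightarrow> reduced (inverse_word w)"
  unfolding inverse_word_def reduced_def successively_rev successively_map
  by (erule successively_mono) auto

lemma not_reduced_split:
  "\<not> reduced w \<Longrightarrow> \<exists>a u b. w = a @ u # flip u # b"
proof (induction w)
  case (Cons u w)
  show ?case
  proof (cases "reduced w")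
    case True
    with Cons.prems obtain v w' where "w = v # w'" "v = flip u"
      by (cases w) (auto simp: reduced_Cons)
    then show ?thesis by (metis append_Nil)
  next
    case False
    with Cons.IH show ?thesis by (metis append_Cons)
  qed
qed simp


section \<open>Cosets and normal closures inside a subgroup\<close>

lemma (in group) r_coset_eq_iff:
  assumes H: "subgroup H G" and "x \<in> carrier G" "y \<in> carrier G"
  shows "H #> x = H #> y \<longleftrightarrow> x \<otimes> inv y \<in> H"
proof
  assume "H #> x = H #> y"
  then have "x \<in> H #> y" using rcos_self[OF assms(2) H] by simp
  then obtain h where "h \<in> H" "x = h \<otimes> y" by (auto simp: r_coset_def)
  then show "x \<otimes> inv y \<in> H"
    using assms subgroup.mem_carrier[OF H] by (simp add: m_assoc)
next
  assume "x \<otimes> inv y \<in> H"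
  then have "H #> (x \<otimes> inv y) #> y = H #> y"
    using coset_join2[OF _ H] subgroup.mem_carrier[OF H] by simp
  moreover have "H #> (x \<otimes> inv y) #> y = H #> x"
    using assms subgroup.subset[OF H] by (simp add: coset_mult_assoc m_assoc)
  ultimately show "H #> x = H #> y" by simp
qed

lemma (in group) normal_closure_in_subgroup_subset:
  assumes H: "subgroup H G" and N: "N \<subseteq> H" "g \<in> N" "\<one> \<in> N"
    and mult: "\<And>x y. x \<in> N \<Longrightarrow> y \<in> N \<Longrightarrow> x \<otimes> y \<in> N"
    and inv: "\<And>x. x \<in> N \<Longrightarrow> inv x \<in> N"
    and conj: "\<And>h x. h \<in> H \<Longrightarrow> x \<in> N \<Longrightarrow> h \<otimes> x \<otimes> inv h \<in> N"
  shows "normal_closure (G\<lparr>carrier := H\<rparr>) g \<subseteq> N"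
proof (rule normal_closure_least)
  interpret K: group "G\<lparr>carrier := H\<rparr>"
    using H by (rule subgroup_imp_group)
  have K_inv: "inv\<^bsub>G\<lparr>carrier := H\<rparr>\<^esub> x = inv x" if "x \<in> H" for x
    using m_inv_consistent[OF H that] .
  have "subgroup N (G\<lparr>carrier := H\<rparr>)"
    using N mult inv K_inv by unfold_locales auto
  then show "N \<lhd> G\<lparr>carrier := H\<rparr>"
    unfolding K.normal_inv_iff using conj K_inv by auto
qed (rule N)

section \<open>Words and elements of a free group\<close>

locale free_group = group F for F :: "('a, 'b) monoid_scheme" (structure) +
  fixes S :: "'a set"
  assumes basis: "free_basis F S"
begin

abbreviation letter :: "'a \<times> bool \<Rightarrow> 'a" where
  "letter u \<equiv> if snd u then fst u else inv (fst u)"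

abbreviation word_over :: "('a \<times> bool) list \<Rightarrow> bool" where
  "word_over w \<equiv> fst ` set w \<subseteq> S"

definition word :: "'a \<Rightarrow> ('a \<times> bool) list" where
  "word x = (THE w. w \<in> reduced_words S \<and> word_eval F w = x)"

lemma basis_carrier: "s \<in> S \<Longrightarrow> s \<in> carrier F"
  using basis by (auto simp: free_basis_def)

lemma letter_closed [simp]: "fst u \<in> S \<Longrightarrow> letter u \<in> carrier F"
  by (auto intro: basis_carrier)

lemma eval_closed [simp]: "word_over w \<Longrightarrow> word_eval F w \<in> carrier F"
  by (induction w) (auto intro: basis_carrier)

lemma eval_append:
  "word_over v \<Longrightarrow> word_over w \<Longrightarrow> word_eval F (v @ w) = word_eval F v \<otimes> word_eval F w"
  by (induction v) (auto simp: m_assoc intro: basis_carrier)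

lemma letter_flip: "fst u \<in> S \<Longrightarrow> letter (flip u) = inv (letter u)"
  by (simp add: basis_carrier)

lemma word_over_inverse_word [simp]: "fst ` set (inverse_word w) = fst ` set w"
  by (force simp: inverse_word_def)

lemma eval_inverse_word:
  "word_over w \<Longrightarrow> word_eval F (inverse_word w) = inv (word_eval F w)"
proof (induction w)
  case (Cons u w)
  have over: "word_over (inverse_word w)" "word_over [flip u]"
    using Cons.prems by auto
  have "word_eval F (inverse_word (u # w)) = word_eval F (inverse_word w) \<otimes> letter (flip u)"
    using eval_append[OF over] Cons.prems letter_closed[of "flip u"] by (simp add: inverse_word_def)
  then show ?case
    using Cons letter_flip[of u] letter_closed[of u] by (simp add: inv_mult_group)
qed (simp add: inverse_word_def)

lemma eval_cancel_cons:
  assumes "fst u \<in> S" "word_over w"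
  shows "word_eval F (cancel_cons u w) = letter u \<otimes> word_eval F w"
proof (cases w)
  case (Cons v w')
  have "letter u \<otimes> (letter (flip u) \<otimes> word_eval F w') = word_eval F w'"
    using assms Cons letter_flip[of u] letter_closed[of u] by (simp add: m_assoc[symmetric])
  then show ?thesis using Cons by auto
qed simp

lemma word_over_free_reduce: "word_over w \<Longrightarrow> word_over (free_reduce w)"
  using set_free_reduce by blast

lemma eval_free_reduce: "word_over w \<Longrightarrow> word_eval F (free_reduce w) = word_eval F w"
  by (induction w) (auto simp: eval_cancel_cons word_over_free_reduce basis_carrier)

lemma word_eval_word:
  assumes "x \<in> carrier F"
  shows "word_over (word x)" "reduced (word x)" "word_eval F (word x) = x"
proof -
  have inj: "inj_on (word_eval F) (reduced_words S)"
    and surj: "word_eval F ` reduced_words S = carrier F"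
    using basis by (simp_all add: free_basis_def bij_betw_def)
  from assms surj obtain w where w: "w \<in> reduced_words S" "word_eval F w = x"
    by (metis imageE)
  then have "\<exists>!w. w \<in> reduced_words S \<and> word_eval F w = x"
    using inj by (metis inj_onD)
  from theI'[OF this] show "word_over (word x)" "reduced (word x)" "word_eval F (word x) = x"
    by (auto simp: word_def reduced_words_eq)
qed

text \<open>
  The bridge from words to elements: whatever is invariant under free reduction of words is a
  function on the group.
\<close>
lemma free_reduce_eq_word: "word_over w \<Longrightarrow> free_reduce w = word (word_eval F w)"
proof -
  assume w: "word_over w"
  have "inj_on (word_eval F) (reduced_words S)"
    using basis by (simp add: free_basis_def bij_betw_def)
  moreover have "free_reduce w \<in> reduced_words S" "word (word_eval F w) \<in> reduced_words S"
    using w word_over_free_reduce reduced_free_reduce word_eval_word[OF eval_closed]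
    by (auto simp: reduced_words_eq)
  moreover have "word_eval F (free_reduce w) = word_eval F (word (word_eval F w))"
    using w by (simp add: eval_free_reduce word_eval_word)
  ultimately show ?thesis by (simp add: inj_on_def)
qed

lemma word_mult:
  assumes "x \<in> carrier F" "y \<in> carrier F"
  shows "word (x \<otimes> y) = free_reduce (word x @ word y)"
  using assms free_reduce_eq_word[of "word x @ word y"] by (simp add: word_eval_word eval_append image_Un)

lemma word_one [simp]: "word \<one> = []"
  using free_reduce_eq_word[of "[]"] by simp

lemma word_inv:
  assumes "x \<in> carrier F"
  shows "word (inv x) = inverse_word (word x)"
  using assms free_reduce_eq_word[of "inverse_word (word x)"]
  by (simp add: word_eval_word eval_inverse_word free_reduce_reduced reduced_inverse_word)

abbreviation len :: "'a \<Rightarrow> nat" where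
  "len x \<equiv> length (word x)"

lemma len_eval: "word_over w \<Longrightarrow> len (word_eval F w) \<le> length w"
  using free_reduce_eq_word[of w] length_free_reduce[of w] by simp

lemma len_mult: "x \<in> carrier F \<Longrightarrow> y \<in> carrier F \<Longrightarrow> len (x \<otimes> y) \<le> len x + len y"
  using length_free_reduce[of "word x @ word y"] by (simp add: word_mult)

lemma len_inv: "x \<in> carrier F \<Longrightarrow> len (inv x) = len x"
  by (simp add: word_inv inverse_word_def)

lemma len_int_pow:
  assumes "x \<in> carrier F"
  shows "len (x [^] (k::int)) \<le> nat \<bar>k\<bar> * len x"
proof -
  have nat: "len (x [^] (n::nat)) \<le> n * len x" for n
  proof (induction n)
    case (Suc n)
    have "len (x [^] Suc n) \<le> len (x [^] n) + len x"
      using assms len_mult[of "x [^] n" x] by (simp only: nat_pow_Suc nat_pow_closed)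
    with Suc.IH show ?case by simp
  qed simp
  show ?thesis
  proof (cases k rule: int_cases2)
    case (nonneg n)
    then show ?thesis using nat[of n] by (simp add: int_pow_int)
  next
    case (nonpos n)
    have "len (x [^] k) = len (x [^] n)"
      using assms nonpos int_pow_neg_int[OF assms, of n] len_inv[of "x [^] n"]
      by (simp only: nat_pow_closed)
    then show ?thesis using nat[of n] nonpos by simp
  qed
qed

end

section \<open>The Magnus representation\<close>

text \<open>
  A function \<open>f :: 'c list \<Rightarrow> int\<close> is a power series in noncommuting variables, with \<open>f u\<close> the
  coefficient of the monomial \<open>u\<close>. The two operators below are left multiplication by \<open>1 + s\<close> and
  by its inverse \<open>1 - s + s s - \<dots>\<close>. Letting words act on series avoids the product of series
  altogether.
\<close>
fun magnus_mult :: "'c \<Rightarrow> ('c list \<Rightarrow> int) \<Rightarrow> 'c list \<Rightarrow> int" where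
  "magnus_mult s f [] = f []"
| "magnus_mult s f (a # u) = f (a # u) + (if a = s then f u else 0)"

fun magnus_div :: "'c \<Rightarrow> ('c list \<Rightarrow> int) \<Rightarrow> 'c list \<Rightarrow> int" where
  "magnus_div s f [] = f []"
| "magnus_div s f (a # u) = f (a # u) - (if a = s then magnus_div s f u else 0)"

definition magnus_letter :: "'c \<times> bool \<Rightarrow> ('c list \<Rightarrow> int) \<Rightarrow> 'c list \<Rightarrow> int" where
  "magnus_letter l = (if snd l then magnus_mult (fst l) else magnus_div (fst l))"

definition magnus :: "('c \<times> bool) list \<Rightarrow> ('c list \<Rightarrow> int) \<Rightarrow> 'c list \<Rightarrow> int" where
  "magnus = foldr magnus_letter"

lemma magnus_simps [simp]:
  "magnus [] f = f" "magnus (l # w) f = magnus_letter l (magnus w f)"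
  by (simp_all add: magnus_def)

lemma magnus_append: "magnus (v @ w) f = magnus v (magnus w f)"
  by (simp add: magnus_def)

lemma magnus_letter_flip: "magnus_letter l (magnus_letter (flip l) f) = f"
proof
  fix u
  have "magnus_mult s (magnus_div s f) u = f u" "magnus_div s (magnus_mult s f) u = f u" for s
    by (induction u) auto
  then show "magnus_letter l (magnus_letter (flip l) f) u = f u"
    by (simp add: magnus_letter_def)
qed

lemma magnus_free_reduce: "magnus (free_reduce w) f = magnus w f"
proof (induction w)
  case (Cons l w)
  have "magnus (cancel_cons l v) f = magnus (l # v) f" for v
    by (cases v) (auto simp: magnus_letter_flip)
  with Cons show ?case by simp
qed simp

lemma magnus_diff: "magnus w (f - f') = magnus w f - magnus w f'"
proof (induction w)
  case (Cons l w)
  have "magnus_mult s (f - f') u = magnus_mult s f u - magnus_mult s f' u"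
    "magnus_div s (f - f') u = magnus_div s f u - magnus_div s f' u" for s u and f f' :: "'a list \<Rightarrow> int"
    by (induction u) auto
  then have "magnus_letter l (f - f') = magnus_letter l f - magnus_letter l f'" for f f'
    by (auto simp: magnus_letter_def fun_eq_iff)
  with Cons show ?case by (simp only: magnus_simps)
qed simp

definition vanishes :: "nat \<Rightarrow> ('c list \<Rightarrow> int) \<Rightarrow> bool" where
  "vanishes m f \<longleftrightarrow> (\<forall>u. length u < m \<longrightarrow> f u = 0)"

lemma vanishes_add: "vanishes m f \<Longrightarrow> vanishes m f' \<Longrightarrow> vanishes m (f + f')"
  by (simp add: vanishes_def)

lemma vanishes_diff: "vanishes m f \<Longrightarrow> vanishes m f' \<Longrightarrow> vanishes m (f - f')"
  by (simp add: vanishes_def)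

lemma vanishes_mono: "vanishes m f \<Longrightarrow> n \<le> m \<Longrightarrow> vanishes n f"
  by (simp add: vanishes_def)

text \<open>Every letter is \<open>1\<close> plus terms of positive degree, so words act unipotently.\<close>
lemma vanishes_magnus_diff_self: "vanishes m f \<Longrightarrow> vanishes (Suc m) (magnus w f - f)"
proof (induction w)
  case Nil
  then show ?case by (simp add: vanishes_def)
next
  case (Cons l w)
  have "vanishes m (magnus w f)"
    using vanishes_add[OF vanishes_mono[OF Cons.IH[OF Cons.prems], of m] Cons.prems]
    by (simp only: diff_add_cancel le_SucI order.refl)
  moreover have "vanishes (Suc m) (magnus_letter l h - h)" if h: "vanishes m h" for h
  proof -
    have "magnus_div s h u = h u \<and> (length u < m \<longrightarrow> magnus_div s h u = 0)"
      if "length u \<le> m" for s u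
      using that h by (induction u) (auto simp: vanishes_def)
    moreover have "magnus_mult s h u = h u" if "length u \<le> m" for s u
      using that h by (cases u) (auto simp: vanishes_def)
    ultimately show ?thesis by (auto simp: vanishes_def magnus_letter_def)
  qed
  ultimately have "vanishes (Suc m) ((magnus_letter l (magnus w f) - magnus w f) + (magnus w f - f))"
    by (intro vanishes_add Cons.IH[OF Cons.prems])
  then show ?case by (simp only: magnus_simps diff_add_cancel add_diff_eq)
qed

lemma vanishes_magnus: "vanishes m f \<Longrightarrow> vanishes m (magnus w f)"
  using vanishes_add[OF vanishes_mono[OF vanishes_magnus_diff_self[of m f w], of m]]
  by (metis diff_add_cancel le_SucI order.refl)

definition constant_one :: "'c list \<Rightarrow> int" where
  "constant_one u = (if u = [] then 1 else 0)"

text \<open>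
  On a monomial \<open>v\<close> without repeated neighbours only the linear term of \<open>(1 + s)\<^sup>\<plusminus>\<^sup>m\<close> can
  contribute, because \<open>s s\<close> is not an initial segment of \<open>v\<close>. So the binomial coefficients
  reduce to \<open>\<plusminus>m\<close>.
\<close>
lemma magnus_replicate_distinct_adj:
  assumes "distinct_adj v"
  shows "magnus (replicate m l) f v =
    f v + (if v \<noteq> [] \<and> hd v = fst l then (if snd l then int m else - int m) * f (tl v) else 0)"
proof -
  have div: "magnus_div s f v = f v" if "v = [] \<or> hd v \<noteq> s" for s f and v :: "'a list"
    using that by (cases v) auto
  have letter: "magnus_letter l f v =
      f v + (if v \<noteq> [] \<and> hd v = fst l then (if snd l then 1 else - 1) * f (tl v) else 0)"
    if "distinct_adj v" for f v
    using that div by (cases v) (auto simp: magnus_letter_def distinct_adj_Cons)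
  show ?thesis using assms
  proof (induction m arbitrary: v)
    case (Suc m)
    have "distinct_adj (tl v)" "tl v \<noteq> [] \<longrightarrow> hd (tl v) \<noteq> hd v"
      using Suc.prems by (cases v; auto simp: distinct_adj_Cons)+
    then show ?case
      using letter[OF Suc.prems] Suc.IH[OF Suc.prems] Suc.IH[of "tl v"]
      by (auto simp: algebra_simps)
  qed simp
qed

lemma leading_block:
  assumes "reduced (l # w)"
  obtains m w' where "l # w = replicate (Suc m) l @ w'" "reduced w'" "w' = [] \<or> fst (hd w') \<noteq> fst l"
proof -
  define b where "b = takeWhile ((=) l) w"
  define w' where "w' = dropWhile ((=) l) w"
  have w: "l # w = (l # b) @ w'" by (simp add: b_def w'_def)
  have b: "b = replicate (length b) l"
    unfolding b_def by (rule replicate_length_same[symmetric]) (auto dest: set_takeWhileD)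
  have "last (l # b) = l"
    using b by (metis last_replicate length_Cons nat.discI replicate_Suc)
  then have "w' = [] \<or> hd w' \<noteq> flip l" "reduced w'"
    using assms unfolding w reduced_append by auto
  moreover have "w' = [] \<or> hd w' \<noteq> l"
    unfolding w'_def by (metis hd_dropWhile)
  ultimately have "w' = [] \<or> fst (hd w') \<noteq> fst l"
    by (auto simp: flip_def prod_eq_iff)
  then show ?thesis using that[of "length b" w'] w b \<open>reduced w'\<close> by simp
qed

text \<open>
  Faithfulness of the Magnus representation. If \<open>w\<close> consists of blocks
  \<open>s\<^sub>1\<^bsup>m\<^sub>1\<^esup> \<dots> s\<^sub>k\<^bsup>m\<^sub>k\<^esup>\<close> with \<open>s\<^sub>i \<noteq> s\<^sub>i\<^sub>+\<^sub>1\<close>, then \<open>u = s\<^sub>1 \<dots> s\<^sub>k\<close> has the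
  coefficient \<open>m\<^sub>1 \<cdots> m\<^sub>k\<close>, and no other monomial without repeated neighbours that is at least as
  long occurs. The second part is what makes the induction over the blocks work.
\<close>
lemma magnus_reduced_coefficient:
  assumes "reduced w"
  shows "\<exists>u. distinct_adj u \<and> length u \<le> length w \<and> magnus w constant_one u \<noteq> 0 \<and>
    (\<forall>v. distinct_adj v \<longrightarrow> length u \<le> length v \<longrightarrow> v \<noteq> u \<longrightarrow> magnus w constant_one v = 0) \<and>
    (if w = [] then u = [] else u \<noteq> [] \<and> hd u = fst (hd w))"
  using assms
proof (induction w rule: length_induct)
  case (1 w)
  show ?case
  proof (cases w)
    case Nil
    then show ?thesis by (intro exI[of _ "[]"]) (simp add: constant_one_def)
  next
    case (Cons l w0)
    with 1 obtain m w' where w: "w = replicate (Suc m) l @ w'" and "reduced w'"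
      and hd: "w' = [] \<or> fst (hd w') \<noteq> fst l"
      using leading_block by metis
    with 1 obtain u where u: "distinct_adj u" "length u \<le> length w'" "magnus w' constant_one u \<noteq> 0"
      "\<And>v. distinct_adj v \<Longrightarrow> length u \<le> length v \<Longrightarrow> v \<noteq> u \<Longrightarrow> magnus w' constant_one v = 0"
      "if w' = [] then u = [] else u \<noteq> [] \<and> hd u = fst (hd w')"
      by (metis length_append length_replicate less_add_same_cancel2 zero_less_Suc)
    define k where "k = (if snd l then int (Suc m) else - int (Suc m))"
    have k: "k \<noteq> 0" by (simp add: k_def)
    have eval: "magnus w constant_one v = magnus w' constant_one v +
        (if v \<noteq> [] \<and> hd v = fst l then k * magnus w' constant_one (tl v) else 0)" if "distinct_adj v" for v
      using magnus_replicate_distinct_adj[OF that, of "Suc m" l "magnus w' constant_one"]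
      unfolding w magnus_append k_def by simp
    have adj: "distinct_adj (fst l # u)"
      using u hd by (auto simp: distinct_adj_Cons split: if_splits)
    have "magnus w constant_one (fst l # u) \<noteq> 0"
      using eval[OF adj] u(3) u(4)[OF adj] k by auto
    moreover have "magnus w constant_one v = 0"
      if v: "distinct_adj v" "length (fst l # u) \<le> length v" "v \<noteq> fst l # u" for v
    proof -
      obtain a v' where v': "v = a # v'" using v(2) by (cases v) auto
      with v(1) have "distinct_adj v'" by (cases v') auto
      moreover have "v \<noteq> u" using v(2) by auto
      ultimately show ?thesis
        using eval[OF v(1)] u(4)[OF v(1)] u(4)[of v'] v v' by auto
    qed
    ultimately show ?thesis
      using adj u(2) w Cons by (intro exI[of _ "fst l # u"]) auto
  qed
qed


text \<open>
  The coefficient of \<open>u\<close> in the image of \<open>f\<close> under a word depends only on the coefficients of \<open>f\<close>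
  at suffixes of \<open>u\<close>.
\<close>
definition bounded_on_suffixes :: "int \<Rightarrow> 'c list \<Rightarrow> ('c list \<Rightarrow> int) \<Rightarrow> bool" where
  "bounded_on_suffixes b u f \<longleftrightarrow> (\<forall>n. \<bar>f (drop n u)\<bar> \<le> b)"

lemma bounded_on_suffixes_Cons:
  "bounded_on_suffixes b (a # u) f \<longleftrightarrow> \<bar>f (a # u)\<bar> \<le> b \<and> bounded_on_suffixes b u f"
  unfolding bounded_on_suffixes_def by (metis drop0 drop_Suc_Cons not0_implies_Suc)

lemma bounded_magnus_letter:
  assumes "bounded_on_suffixes b u f"
  shows "bounded_on_suffixes (int (length u + 2) * b) u (magnus_letter l f)"
proof -
  have b: "b \<ge> 0"
    using assms unfolding bounded_on_suffixes_def by (meson abs_ge_zero order.trans)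
  have mono: "bounded_on_suffixes c v h" if "bounded_on_suffixes b v h" "b \<le> c" for b c v and h :: "'a list \<Rightarrow> int"
    using that unfolding bounded_on_suffixes_def by (meson order.trans)
  have "bounded_on_suffixes (int (length u + 2) * b) u (magnus_mult s f) \<and>
      bounded_on_suffixes (int (length u + 2) * b) u (magnus_div s f)" for s
    using assms
  proof (induction u)
    case Nil
    then show ?case using b by (simp add: bounded_on_suffixes_def)
  next
    case (Cons a u)
    have f: "\<bar>f (a # u)\<bar> \<le> b" "bounded_on_suffixes b u f"
      using Cons.prems by (simp_all add: bounded_on_suffixes_Cons)
    define c where "c = int (length u + 2) * b"
    have c: "int (length (a # u) + 2) * b = c + b" "b \<le> c"
      using b by (simp_all add: c_def algebra_simps)
    have IH: "bounded_on_suffixes c u (magnus_mult s f)" "bounded_on_suffixes c u (magnus_div s f)"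
      using Cons.IH[OF f(2)] by (simp_all add: c_def)
    have "\<bar>f u\<bar> \<le> b" "\<bar>magnus_div s f u\<bar> \<le> c"
      using f(2) IH(2) unfolding bounded_on_suffixes_def by (metis drop0)+
    then show ?case
      using f(1) mono[OF IH(1), of "c + b"] mono[OF IH(2), of "c + b"] b c(2)
      unfolding c(1) bounded_on_suffixes_Cons by auto
  qed
  then show ?thesis by (simp add: magnus_letter_def)
qed

lemma magnus_bounded_by_length:
  "\<exists>b. \<forall>w. length w \<le> n \<longrightarrow> bounded_on_suffixes b u (magnus w f)"
proof (induction n)
  case 0
  have "bounded_on_suffixes (Max ((\<lambda>n. \<bar>f (drop n u)\<bar>) ` {..length u})) u f"
    unfolding bounded_on_suffixes_def
  proof
    fix n
    have "drop n u = drop (min n (length u)) u" by (simp add: min_def)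
    then show "\<bar>f (drop n u)\<bar> \<le> Max ((\<lambda>n. \<bar>f (drop n u)\<bar>) ` {..length u})"
      by (intro Max_ge) auto
  qed
  then show ?case by auto
next
  case (Suc n)
  then obtain b where b: "\<And>w. length w \<le> n \<Longrightarrow> bounded_on_suffixes b u (magnus w f)" by blast
  define c where "c = int (length u + 2) * b"
  have "b \<ge> 0"
    using b[of "[]"] unfolding bounded_on_suffixes_def by (metis abs_ge_zero le0 list.size(3) order.trans)
  then have "b \<le> c" by (simp add: c_def algebra_simps)
  have "bounded_on_suffixes c u (magnus w f)" if "length w \<le> Suc n" for w
  proof (cases w)
    case Nil
    then show ?thesis using b[of "[]"] \<open>b \<le> c\<close> unfolding bounded_on_suffixes_def
      by (metis le0 list.size(3) order.trans)
  next
    case (Cons l w')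
    then have "bounded_on_suffixes b u (magnus w' f)" using that b by simp
    then show ?thesis unfolding Cons c_def magnus_simps by (rule bounded_magnus_letter)
  qed
  then show ?case by blast
qed

context free_group
begin

abbreviation act :: "'a \<Rightarrow> ('a list \<Rightarrow> int) \<Rightarrow> 'a list \<Rightarrow> int" where
  "act x \<equiv> magnus (word x)"

lemma act_one: "act \<one> f = f"
  by simp

lemma act_mult: "x \<in> carrier F \<Longrightarrow> y \<in> carrier F \<Longrightarrow> act (x \<otimes> y) f = act x (act y f)"
  by (simp add: word_mult magnus_free_reduce magnus_append)

text \<open>
  Congruence modulo the \<open>n\<close>-th dimension subgroup, the group of all elements that act as \<open>1\<close> plus
  terms of degree at least \<open>n\<close>.
\<close>
definition cong_deg :: "nat \<Rightarrow> 'a \<Rightarrow> 'a \<Rightarrow> bool" where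
  "cong_deg n x y \<longleftrightarrow> (\<forall>m f. vanishes m f \<longrightarrow> vanishes (m + n) (act x f - act y f))"

lemma cong_degI: "(\<And>m f. vanishes m f \<Longrightarrow> vanishes (m + n) (act x f - act y f)) \<Longrightarrow> cong_deg n x y"
  unfolding cong_deg_def by blast

lemma cong_degD: "cong_deg n x y \<Longrightarrow> vanishes m f \<Longrightarrow> vanishes (m + n) (act x f - act y f)"
  by (simp only: cong_deg_def)

lemma cong_deg_refl: "cong_deg n x x"
  by (simp add: cong_deg_def vanishes_def)

lemma cong_deg_sym: "cong_deg n x y \<Longrightarrow> cong_deg n y x"
  by (simp add: cong_deg_def vanishes_def)

lemma cong_deg_trans:
  assumes "cong_deg n x y" "cong_deg n y z"
  shows "cong_deg n x z"
proof (rule cong_degI)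
  fix m f
  assume "vanishes m (f :: 'a list \<Rightarrow> int)"
  then have "vanishes (m + n) ((act x f - act y f) + (act y f - act z f))"
    by (intro vanishes_add cong_degD[OF assms(1)] cong_degD[OF assms(2)])
  then show "vanishes (m + n) (act x f - act z f)" by (simp only: add_diff_eq diff_add_cancel)
qed

lemma cong_deg_mono: "cong_deg n x y \<Longrightarrow> k \<le> n \<Longrightarrow> cong_deg k x y"
  unfolding cong_deg_def by (meson add_left_mono vanishes_mono)

text \<open>From \<open>xy - x'y' = x (y - y') + (x - x') y'\<close> for the operators.\<close>
lemma cong_deg_mult:
  assumes "cong_deg n x x'" "cong_deg n y y'"
    and "x \<in> carrier F" "y \<in> carrier F" "x' \<in> carrier F" "y' \<in> carrier F"
  shows "cong_deg n (x \<otimes> y) (x' \<otimes> y')"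
proof (rule cong_degI)
  fix m f
  assume f: "vanishes m (f :: 'a list \<Rightarrow> int)"
  have "vanishes (m + n) (act x (act y f - act y' f) + (act x (act y' f) - act x' (act y' f)))"
    using f by (intro vanishes_add vanishes_magnus cong_degD[OF assms(1)] cong_degD[OF assms(2)])
  then show "vanishes (m + n) (act (x \<otimes> y) f - act (x' \<otimes> y') f)"
    using assms by (simp only: act_mult magnus_diff add_diff_eq diff_add_cancel)
qed

lemma cong_deg_inv:
  assumes "cong_deg n x y" "x \<in> carrier F" "y \<in> carrier F"
  shows "cong_deg n (inv x) (inv y)"
proof -
  have "cong_deg n (inv x \<otimes> (y \<otimes> inv y)) (inv x \<otimes> (x \<otimes> inv y))"
    using assms by (intro cong_deg_mult cong_deg_refl cong_deg_sym[OF assms(1)]) auto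
  moreover have "inv x \<otimes> (x \<otimes> inv y) = inv y"
    using assms by (simp add: m_assoc[symmetric])
  ultimately show ?thesis using assms by simp
qed

lemma cong_deg_1: "cong_deg 1 x \<one>"
  by (rule cong_degI) (simp only: act_one vanishes_magnus_diff_self flip: Suc_eq_plus1)

text \<open>
  The dimension subgroups form a central series: if \<open>x = y + d\<close> as operators, with \<open>y\<close> commuting
  with \<open>z\<close>, then \<open>xz - zx = d (z - 1) - (z - 1) d\<close>, and \<open>z - 1\<close> raises degrees by one more.
\<close>
lemma cong_deg_commute:
  assumes "cong_deg n x y" "y \<otimes> z = z \<otimes> y"
    and [simp]: "x \<in> carrier F" "y \<in> carrier F" "z \<in> carrier F"
  shows "cong_deg (Suc n) (x \<otimes> z) (z \<otimes> x)"
proof (rule cong_degI)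
  fix m f
  assume f: "vanishes m (f :: 'a list \<Rightarrow> int)"
  define d where "d = (\<lambda>f. act x f - act y f)"
  have d_diff: "d (f - f') = d f - d f'" for f f'
    by (simp only: d_def magnus_diff) (simp add: algebra_simps)
  have "vanishes (Suc m + n) (d (act z f - f))"
    unfolding d_def by (rule cong_degD[OF assms(1)], rule vanishes_magnus_diff_self, rule f)
  moreover have "vanishes (Suc (m + n)) (act z (d f) - d f)"
    unfolding d_def by (rule vanishes_magnus_diff_self, rule cong_degD[OF assms(1)], rule f)
  ultimately have "vanishes (Suc (m + n)) (d (act z f - f) - (act z (d f) - d f))"
    unfolding add_Suc by (rule vanishes_diff)
  moreover have "act y (act z f) = act z (act y f)"
    using assms(2) by (simp add: act_mult[symmetric])
  then have "act (x \<otimes> z) f - act (z \<otimes> x) f = d (act z f - f) - (act z (d f) - d f)"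
    unfolding d_diff by (simp add: d_def act_mult magnus_diff)
  ultimately show "vanishes (m + Suc n) (act (x \<otimes> z) f - act (z \<otimes> x) f)"
    by (simp only: add_Suc_right)
qed

lemma cong_deg_one_short:
  assumes "x \<in> carrier F" "cong_deg n x \<one>" "len x < n"
  shows "x = \<one>"
proof (rule ccontr)
  assume "x \<noteq> \<one>"
  then have "word x \<noteq> []"
    using assms(1) word_eval_word(3)[of x] by auto
  then obtain u where u: "u \<noteq> []" "length u \<le> len x" "act x constant_one u \<noteq> 0"
    using magnus_reduced_coefficient[OF word_eval_word(2)[OF assms(1)]] by auto
  have "vanishes (0 + n) (act x constant_one - act \<one> constant_one)"
    by (rule cong_degD[OF assms(2)]) (simp add: vanishes_def)
  then have "act x constant_one u = constant_one u"
    using u assms(3) by (simp add: vanishes_def)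
  with u show False by (simp add: constant_one_def)
qed


text \<open>
  Let \<open>r\<close> be the largest degree in which \<open>g\<close> is congruent to \<open>1\<close>. The terms of \<open>g - 1\<close> that raise
  degrees by exactly \<open>r\<close> depend additively on \<open>g\<close>, since \<open>(x - 1) (y - 1)\<close> raises degrees by
  \<open>2r > r\<close>. As they are not all zero, a coefficient \<open>c\<close> of such a term detects the exponent of
  a power of \<open>g\<close>, even of one that is known only up to congruence in degree \<open>n = r + 1\<close>.
\<close>
lemma leading_coefficient:
  assumes g: "g \<in> carrier F" "g \<noteq> \<one>"
  obtains n f u c where "c \<noteq> 0"
    "\<And>k x. cong_deg n x (g [^] (k::int)) \<Longrightarrow> act x f u = f u + k * c"
proof -
  define r where "r = (GREATEST r. cong_deg r g \<one>)"
  have bound: "\<forall>r. cong_deg r g \<one> \<longrightarrow> r \<le> len g"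
    using cong_deg_one_short[of g] g by (meson not_le)
  have r: "cong_deg r g \<one>"
    unfolding r_def by (rule GreatestI_nat[of _ 1 "len g"]) (use bound cong_deg_1 in auto)
  have "1 \<le> r"
    unfolding r_def by (rule Greatest_le_nat[of _ 1 "len g"]) (use bound cong_deg_1 in auto)
  have "\<not> cong_deg (Suc r) g \<one>"
    using Greatest_le_nat[of "\<lambda>r. cong_deg r g \<one>" "Suc r" "len g"] bound unfolding r_def by auto
  then obtain m f u where f: "vanishes m f" and u: "length u < m + Suc r" "(act g f - act \<one> f) u \<noteq> 0"
    unfolding cong_deg_def vanishes_def by blast
  define \<phi> where "\<phi> x = (act x f - f) u" for x
  \<comment> \<open>The coefficient of \<open>u\<close> does not see the product \<open>(x - 1) (y - 1)\<close>.\<close>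
  have \<phi>_mult: "\<phi> (x \<otimes> y) = \<phi> x + \<phi> y"
    if xy: "x \<in> carrier F" "y \<in> carrier F" "cong_deg r x \<one>" "cong_deg r y \<one>" for x y
  proof -
    have "vanishes (m + r) (act y f - f)"
      using cong_degD[OF xy(4) f] by (simp only: act_one)
    then have "vanishes (m + r + r) (act x (act y f - f) - (act y f - f))"
      using cong_degD[OF xy(3)] by (metis act_one)
    then have "(act x (act y f - f) - (act y f - f)) u = 0"
      using u(1) \<open>1 \<le> r\<close> unfolding vanishes_def by auto
    then show ?thesis
      using xy(1,2) unfolding magnus_diff by (simp add: \<phi>_def act_mult)
  qed
  have pow_cong: "cong_deg r (g [^] n) \<one>" for n :: nat
  proof (induction n)
    case (Suc n)
    then show ?case using cong_deg_mult[OF Suc.IH r] g by simp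
  qed (simp add: cong_deg_refl)
  have \<phi>_nat: "\<phi> (g [^] n) = int n * \<phi> g" for n :: nat
  proof (induction n)
    case (Suc n)
    then show ?case
      using \<phi>_mult[OF _ g(1) pow_cong r, of n] g by (simp add: algebra_simps)
  qed (simp add: \<phi>_def)
  have \<phi>_int: "\<phi> (g [^] k) = k * \<phi> g" for k :: int
  proof (cases k rule: int_cases2)
    case (nonneg n)
    then show ?thesis using \<phi>_nat by (simp add: int_pow_int)
  next
    case (nonpos n)
    have "cong_deg r (inv (g [^] n)) \<one>"
      using cong_deg_inv[OF pow_cong[of n]] g by simp
    then have "\<phi> (inv (g [^] n) \<otimes> g [^] n) = \<phi> (inv (g [^] n)) + \<phi> (g [^] n)"
      using g by (intro \<phi>_mult pow_cong) auto
    moreover have "inv (g [^] n) \<otimes> g [^] n = \<one>" using g by simp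
    moreover have "\<phi> \<one> = 0" by (simp add: \<phi>_def)
    ultimately have "\<phi> (inv (g [^] n)) = - (int n * \<phi> g)" using \<phi>_nat[of n] by simp
    moreover have "g [^] k = inv (g [^] n)" using nonpos int_pow_neg_int[OF g(1)] by simp
    ultimately show ?thesis using nonpos by simp
  qed
  have "act x f u = f u + k * \<phi> g" if "cong_deg (Suc r) x (g [^] k)" for x and k :: int
  proof -
    have "(act x f - act (g [^] k) f) u = 0"
      using cong_degD[OF that f] u(1) by (simp only: vanishes_def)
    then show ?thesis using \<phi>_int[of k] by (simp add: \<phi>_def)
  qed
  moreover have "\<phi> g \<noteq> 0" using u(2) by (simp add: \<phi>_def)
  ultimately show ?thesis using that by blast
qed

text \<open>
  In a nilpotent group the chain of subnormal closures of \<open>g\<close> descends to \<open>\<langle>g\<rangle>\<close>; each step gains one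
  term of the central series.
\<close>
lemma subnormal_closure_cong_power:
  assumes g: "g \<in> carrier F"
  shows "x \<in> subnormal_closure F g l \<Longrightarrow> \<exists>k::int. cong_deg (Suc l) x (g [^] k)"
proof (induction l arbitrary: x)
  case 0
  show ?case using cong_deg_1[of x] by (intro exI[of _ 0]) simp
next
  case (Suc l)
  define H where "H = subnormal_closure F g l"
  define N where "N = {x \<in> H. \<exists>k::int. cong_deg (Suc (Suc l)) x (g [^] k)}"
  have H: "subgroup H F" "g \<in> H"
    using subnormal_closure_subgroup[OF g] by (auto simp: H_def)
  note Hc [simp] = subgroup.mem_carrier[OF H(1)]
  note gc [simp] = g
  have "normal_closure (F\<lparr>carrier := H\<rparr>) g \<subseteq> N"
  proof (rule normal_closure_in_subgroup_subset[OF H(1)])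
    show "g \<in> N"
      using H(2) cong_deg_refl[of _ g] by (auto simp: N_def intro!: exI[of _ 1])
    show "\<one> \<in> N"
      using subgroup.one_closed[OF H(1)] cong_deg_refl[of _ \<one>]
      by (auto simp: N_def intro!: exI[of _ 0])
  next
    fix x y assume "x \<in> N" "y \<in> N"
    then obtain j k where x: "x \<in> H" "cong_deg (Suc (Suc l)) x (g [^] (j::int))"
      and y: "y \<in> H" "cong_deg (Suc (Suc l)) y (g [^] (k::int))" by (auto simp: N_def)
    then have "cong_deg (Suc (Suc l)) (x \<otimes> y) (g [^] (j + k))"
      using cong_deg_mult[OF x(2) y(2)] by (simp add: int_pow_mult)
    then show "x \<otimes> y \<in> N"
      using x y subgroup.m_closed[OF H(1)] by (auto simp: N_def)
  next
    fix x assume "x \<in> N"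
    then obtain k where x: "x \<in> H" "cong_deg (Suc (Suc l)) x (g [^] (k::int))"
      by (auto simp: N_def)
    then have "cong_deg (Suc (Suc l)) (inv x) (g [^] (- k))"
      using cong_deg_inv[OF x(2)] by (simp add: int_pow_neg)
    then show "inv x \<in> N"
      using x subgroup.m_inv_closed[OF H(1)] by (auto simp: N_def)
  next
    fix h x assume h: "h \<in> H" and "x \<in> N"
    then obtain k where x: "x \<in> H" "cong_deg (Suc (Suc l)) x (g [^] (k::int))"
      by (auto simp: N_def)
    obtain j :: int where j: "cong_deg (Suc l) h (g [^] j)"
      using Suc.IH h by (auto simp: H_def)
    have "g [^] j \<otimes> g [^] k = g [^] k \<otimes> g [^] j"
      by (simp add: int_pow_mult[symmetric] add.commute)
    then have "cong_deg (Suc (Suc l)) (h \<otimes> g [^] k) (g [^] k \<otimes> h)"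
      using h by (intro cong_deg_commute[OF j]) auto
    moreover have "cong_deg (Suc (Suc l)) (h \<otimes> x) (h \<otimes> g [^] k)"
      using h x by (intro cong_deg_mult cong_deg_refl) auto
    ultimately have hx: "cong_deg (Suc (Suc l)) (h \<otimes> x) (g [^] k \<otimes> h)"
      by (meson cong_deg_trans)
    have "cong_deg (Suc (Suc l)) (h \<otimes> x \<otimes> inv h) (g [^] k \<otimes> h \<otimes> inv h)"
      by (rule cong_deg_mult[OF hx cong_deg_refl]) (use h x in auto)
    then have "cong_deg (Suc (Suc l)) (h \<otimes> x \<otimes> inv h) (g [^] k)"
      using h by (simp add: m_assoc)
    then show "h \<otimes> x \<otimes> inv h \<in> N"
      using x h subgroup.m_closed[OF H(1)] subgroup.m_inv_closed[OF H(1)] by (auto simp: N_def)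
  qed (auto simp: N_def)
  then show ?case using Suc.prems by (auto simp: H_def N_def)
qed


text \<open>
  The bound on the exponent \<open>k\<close> depends on \<open>L\<close> but not on \<open>l\<close>, so \<open>l\<close> can be chosen larger than the
  length of all the elements \<open>x g\<^sup>-\<^sup>k\<close> that occur.
\<close>
lemma short_element_cyclic:
  assumes g: "g \<in> carrier F"
  obtains l0 where "\<And>l x. l0 \<le> l \<Longrightarrow> x \<in> subnormal_closure F g l \<Longrightarrow> len x \<le> L \<Longrightarrow> x \<in> generate F {g}"
proof -
  have pow: "g [^] (k::int) \<in> generate F {g}" for k
    using generate_pow[OF g] by blast
  have sub: "x \<in> carrier F" if "x \<in> subnormal_closure F g l" for x l
    by (rule subgroup.mem_carrier[OF _ that]) (use subnormal_closure_subgroup[OF g] in blast)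
  obtain K n where K: "\<And>x k. len x \<le> L \<Longrightarrow> cong_deg n x (g [^] (k::int)) \<Longrightarrow> len (g [^] k) \<le> K"
  proof (cases "g = \<one>")
    case True
    then show ?thesis using that[of 0 0] by (simp add: int_pow_one)
  next
    case False
    obtain n f u c where c: "c \<noteq> 0"
      and act: "\<And>k x. cong_deg n x (g [^] (k::int)) \<Longrightarrow> act x f u = f u + k * c"
      by (rule leading_coefficient[OF g False]) blast
    obtain b where b: "\<And>w. length w \<le> L \<Longrightarrow> bounded_on_suffixes b u (magnus w f)"
      using magnus_bounded_by_length[of L u f] by blast
    have "len (g [^] k) \<le> nat (b + \<bar>f u\<bar>) * len g"
      if "len x \<le> L" "cong_deg n x (g [^] (k::int))" for x k
    proof -
      have "\<bar>act x f u\<bar> \<le> b"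
        using b[OF that(1)] unfolding bounded_on_suffixes_def by (metis drop0)
      then have "\<bar>k * c\<bar> \<le> b + \<bar>f u\<bar>" using act[OF that(2)] by linarith
      moreover have "\<bar>k\<bar> * 1 \<le> \<bar>k * c\<bar>"
        unfolding abs_mult using c by (intro mult_left_mono) auto
      ultimately have "nat \<bar>k\<bar> * len g \<le> nat (b + \<bar>f u\<bar>) * len g"
        by (intro mult_right_mono) auto
      then show ?thesis using len_int_pow[OF g, of k] by (rule order.trans[rotated])
    qed
    then show ?thesis using that by blast
  qed
  have "x \<in> generate F {g}"
    if l: "max n (L + K) \<le> l" and x: "x \<in> subnormal_closure F g l" "len x \<le> L" for x l
  proof -
    note xF = sub[OF x(1)]
    obtain k :: int where k: "cong_deg (Suc l) x (g [^] k)"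
      using subnormal_closure_cong_power[OF g x(1)] by blast
    have "cong_deg n x (g [^] k)" by (rule cong_deg_mono[OF k]) (use l in simp)
    then have "len (g [^] k) \<le> K" using K x(2) by blast
    then have "len (x \<otimes> inv (g [^] k)) < Suc l"
      using len_mult[OF xF, of "inv (g [^] k)"] len_inv[of "g [^] k"] g l x(2) by simp
    moreover have "cong_deg (Suc l) (x \<otimes> inv (g [^] k)) (g [^] k \<otimes> inv (g [^] k))"
      by (rule cong_deg_mult[OF k cong_deg_refl]) (use g xF in auto)
    ultimately have "x \<otimes> inv (g [^] k) = \<one>"
      using cong_deg_one_short[of "x \<otimes> inv (g [^] k)" "Suc l"] g xF by simp
    then have "x = g [^] k"
      using inv_equality[of x "inv (g [^] k)"] g xF by simp
    then show ?thesis using pow by simp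
  qed
  then show ?thesis by (rule that)
qed

end

section \<open>Paths in the coset graph\<close>

lemma filter_eq_append_split:
  "filter P xs = ys @ zs \<Longrightarrow> \<exists>us vs. xs = us @ vs \<and> filter P us = ys \<and> filter P vs = zs"
proof (induction xs arbitrary: ys)
  case (Cons x xs)
  show ?case
  proof (cases "P x \<and> ys \<noteq> []")
    case True
    then obtain ys' where "ys = x # ys'" "filter P xs = ys' @ zs"
      using Cons.prems by (cases ys) auto
    with Cons.IH True show ?thesis by (metis append_Cons filter.simps(2))
  next
    case False
    show ?thesis
    proof (cases "ys = []")
      case True
      then show ?thesis using Cons.prems by (metis append_Nil filter.simps(1))
    next
      case False
      then have "\<not> P x" "filter P xs = ys @ zs" using \<open>\<not> (P x \<and> ys \<noteq> [])\<close> Cons.prems by auto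
      with Cons.IH show ?thesis by (metis append_Cons filter.simps(2))
    qed
  qed
qed simp

context free_group
begin

text \<open>
  The word \<open>w\<close> labels a path starting at the coset \<open>u\<close>. The edge from \<open>v\<close> to \<open>v #> s\<close> is the pair
  \<open>(v, s)\<close>, and the flag tells whether it is traversed forwards, so that traversing an edge back
  and forth gives two letters that cancel in the sense of \<open>flip\<close>.
\<close>
primrec path_edges :: "'a set \<Rightarrow> ('a \<times> bool) list \<Rightarrow> (('a set \<times> 'a) \<times> bool) list" where
  "path_edges u [] = []"
| "path_edges u (l # w) =
     ((if snd l then u else u #> letter l, fst l), snd l) # path_edges (u #> letter l) w"

lemma length_path_edges [simp]: "length (path_edges u w) = length w"
  by (induction w arbitrary: u) auto

lemma path_edges_append:
  assumes "u \<subseteq> carrier F" "word_over v"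
  shows "path_edges u (v @ w) = path_edges u v @ path_edges (u #> word_eval F v) w"
  using assms
proof (induction v arbitrary: u)
  case (Cons l v)
  have "letter l \<in> carrier F" "word_eval F v \<in> carrier F"
    using Cons.prems letter_closed[of l] eval_closed[of v] by simp_all
  then show ?case
    using Cons.IH[of "u #> letter l"] Cons.prems r_coset_subset_G[of u "letter l"]
      coset_mult_assoc[of u "letter l" "word_eval F v"] by simp
qed simp

lemma coset_step_flip:
  "u \<subseteq> carrier F \<Longrightarrow> fst l \<in> S \<Longrightarrow> (u #> letter l) #> letter (flip l) = u"
  using letter_flip[of l] letter_closed[of l] by (simp only: coset_mult_assoc inv_closed r_inv coset_mult_one)

lemma path_edges_cancel_cons:
  assumes "u \<subseteq> carrier F" "fst l \<in> S"
  shows "path_edges u (l # w) = path_edges u (cancel_cons l w) \<or>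
    (\<exists>e. path_edges u (l # w) = e # flip e # path_edges u (cancel_cons l w))"
proof (cases "\<exists>w'. w = flip l # w'")
  case True
  then obtain w' where w: "w = flip l # w'" by blast
  have "path_edges u (l # flip l # w') =
    ((if snd l then u else u #> letter l, fst l), snd l) #
    flip ((if snd l then u else u #> letter l, fst l), snd l) # path_edges u w'"
    using coset_step_flip[OF assms] by (cases "snd l") (simp_all add: flip_def[of "(_, _)"])
  then show ?thesis unfolding w by simp
next
  case False
  then have "cancel_cons l w = l # w" by (cases w) auto
  then show ?thesis by simp
qed

lemma set_path_edges_free_reduce:
  assumes "u \<subseteq> carrier F" "word_over w"
  shows "set (path_edges u (free_reduce w)) \<subseteq> set (path_edges u w)"
  using assms
proof (induction w arbitrary: u)
  case (Cons l w)
  have l: "letter l \<in> carrier F" "fst l \<in> S" and w: "word_over w"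
    using Cons.prems letter_closed[of l] by simp_all
  have "set (path_edges u (free_reduce (l # w))) \<subseteq> set (path_edges u (l # free_reduce w))"
    using path_edges_cancel_cons[OF Cons.prems(1) l(2), of "free_reduce w"]
    unfolding free_reduce_simps by (elim disjE exE) (simp_all only: list.set, blast+)
  moreover have "set (path_edges u (l # free_reduce w)) \<subseteq> set (path_edges u (l # w))"
    using Cons.IH[OF r_coset_subset_G[OF Cons.prems(1) l(1)] w] by (simp only: path_edges.simps list.set) blast
  ultimately show ?case by (rule order.trans)
qed simp

text \<open>
  Hence the reduced sequence of the edges that satisfy \<open>P\<close> depends only on the group element that
  the word represents.
\<close>
lemma free_reduce_filter_path_edges:
  assumes "u \<subseteq> carrier F" "word_over w" "\<And>e. P (flip e) = P e"
  shows "free_reduce (filter P (path_edges u (free_reduce w))) = free_reduce (filter P (path_edges u w))"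
  using assms(1,2)
proof (induction w arbitrary: u)
  case (Cons l w)
  have l: "letter l \<in> carrier F" "fst l \<in> S" and w: "word_over w"
    using Cons.prems letter_closed[of l] by simp_all
  have cancel: "free_reduce (filter P (e # flip e # es)) = free_reduce (filter P es)" for e es
    using assms(3)[of e] by (simp add: cancel_cons_flip reduced_free_reduce)
  have "free_reduce (filter P (path_edges u (free_reduce (l # w)))) =
      free_reduce (filter P (path_edges u (l # free_reduce w)))"
    using path_edges_cancel_cons[OF Cons.prems(1) l(2), of "free_reduce w"]
    unfolding free_reduce_simps by (elim disjE exE) (simp_all only: cancel)
  also have "\<dots> = free_reduce (filter P (path_edges u (l # w)))"
    using Cons.IH[OF r_coset_subset_G[OF Cons.prems(1) l(1)] w] by simp
  finally show ?case .
qed simp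

text \<open>The inverse word runs through the same path backwards.\<close>
lemma edges_inverse_word:
  assumes "u \<subseteq> carrier F" "word_over w"
  shows "fst ` set (path_edges (u #> word_eval F w) (inverse_word w)) = fst ` set (path_edges u w)"
  using assms
proof (induction w arbitrary: u)
  case (Cons l w)
  have l: "letter l \<in> carrier F" and w: "word_eval F w \<in> carrier F" "word_over w"
    using Cons.prems letter_closed[of l] eval_closed[of w] by simp_all
  define v where "v = u #> letter l"
  have v: "v \<subseteq> carrier F" using r_coset_subset_G[OF Cons.prems(1) l] by (simp add: v_def)
  have uw: "u #> word_eval F (l # w) = v #> word_eval F w"
    using l w Cons.prems by (simp add: v_def coset_mult_assoc)
  have "v #> word_eval F w #> word_eval F (inverse_word w) = v"
    using v w by (simp only: eval_inverse_word coset_mult_assoc inv_closed r_inv coset_mult_one)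
  moreover have "inverse_word (l # w) = inverse_word w @ [flip l]"
    by (simp add: inverse_word_def)
  ultimately have "path_edges (u #> word_eval F (l # w)) (inverse_word (l # w)) =
      path_edges (v #> word_eval F w) (inverse_word w) @ path_edges v [flip l]"
    using path_edges_append[OF r_coset_subset_G[OF v w(1)], of "inverse_word w" "[flip l]"] w(2)
    unfolding uw by (simp only: word_over_inverse_word)
  moreover have "fst ` set (path_edges v [flip l]) = fst ` set (path_edges u [l])"
    using coset_step_flip[of u l] Cons.prems by (auto simp: v_def)
  moreover have "fst ` set (path_edges u (l # w)) =
      fst ` set (path_edges u [l]) \<union> fst ` set (path_edges v w)"
    by (auto simp: v_def)
  ultimately show ?case using Cons.IH[OF v w(2)] by (simp only: set_append image_Un Un_commute)
qed (simp add: inverse_word_def)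

lemma path_edge_endpoints:
  assumes "u \<subseteq> carrier F" "word_over w" "((v, s), b) \<in> set (path_edges u w)"
  shows "\<exists>m n. v = u #> word_eval F (take m w) \<and> v #> s = u #> word_eval F (take n w)"
  using assms
proof (induction w arbitrary: u)
  case (Cons l w)
  have l: "letter l \<in> carrier F" and lS: "fst l \<in> S" and w: "word_over w"
    using Cons.prems letter_closed[of l] by simp_all
  have u': "u #> letter l \<subseteq> carrier F" using r_coset_subset_G[OF Cons.prems(1) l] .
  have shift: "(u #> letter l) #> word_eval F (take n w) = u #> word_eval F (take (Suc n) (l # w))" for n
  proof -
    have "word_over (take n w)" using w set_take_subset[of n w] by blast
    then show ?thesis using Cons.prems(1) l by (simp add: coset_mult_assoc)
  qed
  from Cons.prems(3) consider
    "((v, s), b) \<in> set (path_edges (u #> letter l) w)" |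
    "v = (if snd l then u else u #> letter l)" "s = fst l" by auto
  then show ?case
  proof cases
    case 1
    then show ?thesis using Cons.IH[OF u' w] shift by metis
  next
    case 2
    have ends: "u = u #> word_eval F (take 0 (l # w))" "u #> letter l = u #> word_eval F (take (Suc 0) (l # w))"
      using Cons.prems(1) l by (simp_all add: coset_mult_one)
    have "v #> s = (if snd l then u #> letter l else u)"
      using coset_step_flip[OF Cons.prems(1) lS] unfolding 2 by (cases "snd l") simp_all
    then show ?thesis using 2(1) ends by metis
  qed
qed simp

text \<open>
  Edges and letters correspond one to one, so a position in the filtered sequence of edges gives a
  factorization of the word.
\<close>
lemma filter_path_edges_split:
  assumes "u \<subseteq> carrier F" "word_over w" "filter P (path_edges u w) = es0 @ e # es"
  obtains v l w' where "w = v @ l # w'" "filter P (path_edges u v) = es0"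
    "path_edges (u #> word_eval F v) [l] = [e]"
    "filter P (path_edges (u #> word_eval F (v @ [l])) w') = es" "P e"
proof -
  obtain es0' es2' where split: "path_edges u w = es0' @ es2'" "filter P es0' = es0" "filter P es2' = e # es"
    using filter_eq_append_split[OF assms(3)] by blast
  obtain es1' es2 where split': "es2' = es1' @ e # es2" "\<forall>d\<in>set es1'. \<not> P d" "P e" "filter P es2 = es"
    using filter_eq_ConsD[OF split(3)] by blast
  define es1 where "es1 = es0' @ es1'"
  have es: "path_edges u w = es1 @ e # es2" "filter P es1 = es0" "P e" "filter P es2 = es"
    using split split' by (simp_all add: es1_def filter_empty_conv)
  define v where "v = take (length es1) w"
  have "length es1 < length w"
    using arg_cong[OF es(1), of length] by simp
  then obtain l w' where w: "w = v @ l # w'"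
    unfolding v_def by (metis id_take_nth_drop)
  have v: "word_over v" using assms(2) unfolding w by auto
  have len_v: "length v = length es1" using \<open>length es1 < length w\<close> by (simp add: v_def)
  have v': "u #> word_eval F v \<subseteq> carrier F"
    by (rule r_coset_subset_G[OF assms(1) eval_closed[OF v]])
  have l: "word_over [l]" using assms(2) w by simp
  have "path_edges u v @ path_edges (u #> word_eval F v) [l] @ path_edges (u #> word_eval F (v @ [l])) w' = es1 @ [e] @ es2"
    using path_edges_append[OF assms(1) v, of "l # w'"] es(1) v' l assms(1)
      eval_append[OF v l] letter_closed[of l] eval_closed[OF v]
    unfolding w by (simp add: coset_mult_assoc)
  then have "path_edges u v = es1" "path_edges (u #> word_eval F v) [l] = [e]"
    "path_edges (u #> word_eval F (v @ [l])) w' = es2"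
    using len_v by (auto simp: append_eq_append_conv)
  then show ?thesis using that[of v l w'] w es by simp
qed

end

section \<open>Escape from the loop of \<open>g\<close>\<close>

text \<open>The induction step: \<open>H\<close> is one of the subnormal closures and \<open>D\<close> the bound reached for it.\<close>
locale deep_subgroup = free_group +
  fixes H :: "'a set" and g :: 'a and D :: nat
  assumes H: "subgroup H F" and gH: "g \<in> H"
    and deep: "\<And>x. x \<in> H \<Longrightarrow> x \<notin> generate F {g} \<Longrightarrow> D \<le> len x"
begin

abbreviation loop_edges :: "('a set \<times> 'a) set" where
  "loop_edges \<equiv> fst ` set (path_edges H (word g))"

lemma H_carrier: "x \<in> H \<Longrightarrow> x \<in> carrier F"
  by (rule subgroup.mem_carrier[OF H])

lemma H_subset: "H \<subseteq> carrier F"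
  by (rule subgroup.subset[OF H])

lemma coset_H: "x \<in> H \<Longrightarrow> H #> x = H"
  by (rule coset_join2[OF H_carrier H])

lemma path_edges_word_append:
  "x \<in> H \<Longrightarrow> path_edges H (word x @ w) = path_edges H (word x) @ path_edges H w"
  using path_edges_append[OF H_subset] word_eval_word[OF H_carrier] by (simp add: coset_H)

lemma generate_subset_H: "generate F {g} \<subseteq> H"
  using generate_subgroup_incl[OF _ H] gH by simp

lemma power_edges:
  assumes "x \<in> generate F {g}"
  shows "fst ` set (path_edges H (word x)) \<subseteq> loop_edges"
  using assms
proof (induction rule: generate.induct)
  case (inv h)
  have "H #> word_eval F (word g) = H"
    using word_eval_word(3)[OF H_carrier[OF gH]] by (simp add: coset_H gH)
  then have "fst ` set (path_edges H (inverse_word (word g))) = loop_edges"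
    using edges_inverse_word[OF H_subset word_eval_word(1)[OF H_carrier[OF gH]]] by simp
  with inv show ?case using word_inv[OF H_carrier[OF gH]] by simp
next
  case (eng x y)
  then have xy: "x \<in> H" "y \<in> H" using generate_subset_H by auto
  have "set (path_edges H (word (x \<otimes> y))) \<subseteq> set (path_edges H (word x @ word y))"
    unfolding word_mult[OF xy[THEN H_carrier]]
    by (rule set_path_edges_free_reduce[OF H_subset])
      (use xy[THEN H_carrier] word_eval_word(1) in \<open>simp add: image_Un\<close>)
  then show ?case using eng.IH unfolding path_edges_word_append[OF xy(1)] set_append by blast
qed auto

lemma loop_prefix_over: "word_over (take n (word g))"
  using word_eval_word(1)[OF H_carrier[OF gH]] set_take_subset[of n "word g"] by blast

text \<open>
  Close the path \<open>w\<close> by the inverse of an initial segment \<open>t\<close> of the word of \<open>g\<close>. If the resulting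
  element \<open>x\<close> of \<open>H\<close> were a power of \<open>g\<close>, then \<open>w\<close>, being reduced, would be the reduced form of the
  word of \<open>x\<close> followed by \<open>t\<close>, and reduction creates no edges outside the loop.
\<close>
lemma escaping_path_long:
  assumes w: "word_over w" "reduced w"
    and escapes: "\<not> fst ` set (path_edges H w) \<subseteq> loop_edges"
    and ends: "H #> word_eval F w = H #> word_eval F (take n (word g))"
  shows "D \<le> length w + len g"
proof -
  define t where "t = take n (word g)"
  define x where "x = word_eval F w \<otimes> inv (word_eval F t)"
  have t: "word_over t" using loop_prefix_over by (simp add: t_def)
  have ev: "word_eval F w \<in> carrier F" "word_eval F t \<in> carrier F"
    using w t by simp_all
  have xH: "x \<in> H"
    using ends r_coset_eq_iff[OF H ev] by (simp add: x_def t_def)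
  have "len x \<le> length w + len g"
  proof -
    have "len x \<le> len (word_eval F w) + len (word_eval F t)"
      using len_mult[of "word_eval F w" "inv (word_eval F t)"] ev by (simp add: x_def len_inv)
    also have "\<dots> \<le> length w + length t"
      using len_eval w t by (intro add_mono) auto
    also have "\<dots> \<le> length w + len g" by (simp add: t_def)
    finally show ?thesis .
  qed
  moreover have "x \<notin> generate F {g}"
  proof
    assume x: "x \<in> generate F {g}"
    have over: "word_over (word x @ t)"
      using t word_eval_word(1)[OF H_carrier[OF xH]] by (simp add: image_Un)
    have "word_eval F (word x @ t) = x \<otimes> word_eval F t"
      using eval_append[OF word_eval_word(1)[OF H_carrier[OF xH]] t]
        word_eval_word(3)[OF H_carrier[OF xH]] by simp
    also have "\<dots> = word_eval F w" using ev by (simp add: x_def m_assoc)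
    finally have "free_reduce (word x @ t) = w"
      using free_reduce_eq_word[OF over] free_reduce_eq_word[OF w(1)] free_reduce_reduced[OF w(2)]
      by simp
    then have "set (path_edges H w) \<subseteq> set (path_edges H (word x @ t))"
      using set_path_edges_free_reduce[OF H_subset over] by simp
    moreover have "set (path_edges H t) \<subseteq> set (path_edges H (word g))"
      using path_edges_append[OF H_subset t, of "drop n (word g)"] by (simp add: t_def)
    ultimately have "fst ` set (path_edges H w) \<subseteq> loop_edges"
      using power_edges[OF x] unfolding path_edges_word_append[OF xH] set_append by blast
    with escapes show False by contradiction
  qed
  ultimately show ?thesis using deep[OF xH] by linarith
qed

text \<open>Both ends of a loop edge are reached by initial segments of the word of \<open>g\<close>.\<close>
lemma loop_edge_source:
  assumes u: "u \<subseteq> carrier F" and l: "fst l \<in> S"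
    and e: "fst ` set (path_edges u [l]) \<subseteq> loop_edges"
  shows "\<exists>m. u = H #> word_eval F (take m (word g))"
proof -
  define v where "v = (if snd l then u else u #> letter l)"
  obtain b where "((v, fst l), b) \<in> set (path_edges H (word g))"
    using e by (auto simp: v_def)
  then obtain m n where "v = H #> word_eval F (take m (word g))" "v #> fst l = H #> word_eval F (take n (word g))"
    using path_edge_endpoints[OF H_subset word_eval_word(1)[OF H_carrier[OF gH]]] by blast
  moreover have "u = v \<or> u = v #> fst l"
    using coset_step_flip[OF u l] unfolding v_def by (cases "snd l") simp_all
  ultimately show ?thesis by blast
qed

text \<open>
  Every vertex of the loop is reached by an initial segment of the word of \<open>g\<close>. Writing \<open>t\<^sub>i\<close> for the
  segment that reaches the \<open>i\<close>-th vertex of the path, its element times the inverse of the last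
  segment is the product of \<open>t\<^sub>0\<^sup>-\<^sup>1\<close> and the factors \<open>t\<^sub>i s\<^sub>i t\<^sub>i\<^sub>+\<^sub>1\<^sup>-\<^sup>1\<close>. All of these are elements of
  \<open>H\<close> that are shorter than \<open>D\<close>, hence powers of \<open>g\<close>.
\<close>
lemma path_in_loop_power:
  assumes D: "2 * len g + 2 \<le> D"
    and "word_over w" "fst ` set (path_edges H w) \<subseteq> loop_edges"
    and "H #> word_eval F w = H #> word_eval F (take n (word g))"
  shows "word_eval F w \<otimes> inv (word_eval F (take n (word g))) \<in> generate F {g}"
  using assms(2-)
proof (induction w arbitrary: n rule: rev_induct)
  case Nil
  define t where "t = word_eval F (take n (word g))"
  have t: "t \<in> carrier F" using loop_prefix_over by (simp add: t_def)
  have "\<one> \<otimes> inv t \<in> H"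
    using Nil r_coset_eq_iff[OF H one_closed t] by (simp add: t_def)
  moreover have "len (\<one> \<otimes> inv t) \<le> len g"
    using len_eval[OF loop_prefix_over, of n] t by (simp add: t_def len_inv)
  ultimately have "\<one> \<otimes> inv t \<in> generate F {g}"
    using deep[of "\<one> \<otimes> inv t"] D by linarith
  then show ?case by (simp add: t_def)
next
  case (snoc l w)
  define a where "a = word_eval F w"
  define t where "t = word_eval F (take n (word g))"
  have w: "word_over w" and l: "fst l \<in> S" "letter l \<in> carrier F"
    using snoc.prems(1) letter_closed[of l] by simp_all
  have at: "a \<in> carrier F" "t \<in> carrier F"
    using w loop_prefix_over by (simp_all add: a_def t_def)
  have edges: "path_edges H (w @ [l]) = path_edges H w @ path_edges (H #> a) [l]"
    using path_edges_append[OF H_subset w] by (simp only: a_def)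
  obtain m where m: "H #> a = H #> word_eval F (take m (word g))"
    using loop_edge_source[OF r_coset_subset_G[OF H_subset at(1)] l(1)] snoc.prems(2)
    unfolding edges by (auto simp del: path_edges.simps)
  define p where "p = word_eval F (take m (word g))"
  have p: "p \<in> carrier F" using loop_prefix_over by (simp add: p_def)
  have 1: "a \<otimes> inv p \<in> generate F {g}"
    using snoc.IH[OF w _ m[unfolded a_def]] snoc.prems(2) unfolding edges by (simp add: a_def p_def)
  have al: "word_eval F (w @ [l]) = a \<otimes> letter l"
    using eval_append[OF w, of "[l]"] l by (simp add: a_def)
  have "H #> (p \<otimes> letter l) = H #> t"
    using snoc.prems(3) m coset_mult_assoc[OF H_subset p l(2)] coset_mult_assoc[OF H_subset at(1) l(2)]
    unfolding al p_def t_def by metis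
  then have "p \<otimes> letter l \<otimes> inv t \<in> H"
    using r_coset_eq_iff[OF H m_closed[OF p l(2)] at(2)] by blast
  moreover have "len (p \<otimes> letter l \<otimes> inv t) \<le> 2 * len g + 1"
  proof -
    have "len (p \<otimes> letter l \<otimes> inv t) \<le> len p + len (letter l) + len (inv t)"
      using len_mult[OF m_closed[OF p l(2)] inv_closed[OF at(2)]] len_mult[OF p l(2)] by linarith
    moreover have "len p \<le> len g" "len (inv t) \<le> len g"
      using len_eval[OF loop_prefix_over, of m] len_eval[OF loop_prefix_over, of n] at(2)
      by (simp_all add: p_def t_def len_inv)
    moreover have "len (letter l) \<le> 1" using len_eval[of "[l]"] l by simp
    ultimately show ?thesis by linarith
  qed
  ultimately have 2: "p \<otimes> letter l \<otimes> inv t \<in> generate F {g}"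
    using deep[of "p \<otimes> letter l \<otimes> inv t"] D by linarith
  have "(a \<otimes> inv p) \<otimes> (p \<otimes> letter l \<otimes> inv t) = a \<otimes> letter l \<otimes> inv t"
  proof -
    have "inv p \<otimes> (p \<otimes> (letter l \<otimes> inv t)) = letter l \<otimes> inv t"
      using p l(2) at by (simp only: m_assoc[symmetric] l_inv l_one m_closed inv_closed)
    then show ?thesis using p l(2) at by (simp only: m_assoc m_closed inv_closed)
  qed
  then show ?case using generate.eng[OF 1 2] unfolding al t_def by simp
qed

text \<open>
  On \<open>H\<close> the reduced sequence of edges off the loop is multiplicative, so the elements for which it
  is empty form a normal subgroup of \<open>H\<close>. It contains \<open>g\<close>.
\<close>
lemma normal_closure_trace_trivial:
  assumes "x \<in> normal_closure (F\<lparr>carrier := H\<rparr>) g"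
  shows "x \<in> H \<and> free_reduce (filter (\<lambda>e. fst e \<notin> loop_edges) (path_edges H (word x))) = []"
proof -
  define tr where "tr x = filter (\<lambda>e. fst e \<notin> loop_edges) (path_edges H (word x))" for x
  define N where "N = {x \<in> H. free_reduce (tr x) = []}"
  have tr_mult: "free_reduce (tr (x \<otimes> y)) = free_reduce (tr x @ tr y)" if xy: "x \<in> H" "y \<in> H" for x y
  proof -
    have "word_over (word x @ word y)"
      using word_eval_word(1)[OF H_carrier[OF xy(1)]] word_eval_word(1)[OF H_carrier[OF xy(2)]]
      by (simp add: image_Un)
    from free_reduce_filter_path_edges[OF H_subset this, of "\<lambda>e. fst e \<notin> loop_edges"]
    show ?thesis
      unfolding tr_def word_mult[OF H_carrier[OF xy(1)] H_carrier[OF xy(2)]] path_edges_word_append[OF xy(1)]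
      by (simp only: flip_simps filter_append)
  qed
  have tr_one: "free_reduce (tr \<one>) = []" by (simp add: tr_def)
  have "normal_closure (F\<lparr>carrier := H\<rparr>) g \<subseteq> N"
  proof (rule normal_closure_in_subgroup_subset[OF H])
    show "g \<in> N" using gH by (auto simp: N_def tr_def filter_empty_conv)
    show "\<one> \<in> N" using tr_one subgroup.one_closed[OF H] by (simp add: N_def)
  next
    fix x y assume "x \<in> N" "y \<in> N"
    then show "x \<otimes> y \<in> N"
      using tr_mult subgroup.m_closed[OF H] by (simp add: N_def free_reduce_trivial_prefix)
  next
    fix x assume x: "x \<in> N"
    then have xH: "x \<in> H" "inv x \<in> H" using subgroup.m_inv_closed[OF H] by (simp_all add: N_def)
    have "free_reduce (tr (inv x)) = free_reduce (tr (x \<otimes> inv x))"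
      using x unfolding tr_mult[OF xH] by (simp add: N_def free_reduce_trivial_prefix)
    then show "inv x \<in> N" using xH tr_one H_carrier[OF xH(1)] by (simp add: N_def)
  next
    fix h x assume h: "h \<in> H" and x: "x \<in> N"
    then have H': "x \<in> H" "inv h \<in> H" "x \<otimes> inv h \<in> H"
      using subgroup.m_inv_closed[OF H] subgroup.m_closed[OF H] by (simp_all add: N_def)
    have "free_reduce (tr (x \<otimes> inv h)) = free_reduce (tr (inv h))"
      using x unfolding tr_mult[OF H'(1,2)] by (simp add: N_def free_reduce_trivial_prefix)
    then have "free_reduce (tr (h \<otimes> (x \<otimes> inv h))) = free_reduce (tr h @ tr (inv h))"
      unfolding tr_mult[OF h H'(3)] by (rule free_reduce_append_cong)
    also have "\<dots> = free_reduce (tr (h \<otimes> inv h))" using tr_mult[OF h H'(2)] by simp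
    finally have "free_reduce (tr (h \<otimes> (x \<otimes> inv h))) = []"
      using tr_one H_carrier[OF h] by simp
    moreover have "h \<otimes> (x \<otimes> inv h) = h \<otimes> x \<otimes> inv h"
      using h H'(1) H_carrier by (simp add: m_assoc)
    ultimately show "h \<otimes> x \<otimes> inv h \<in> N"
      using subgroup.m_closed[OF H h H'(3)] by (simp add: N_def)
  qed (auto simp: N_def)
  then show ?thesis using assms by (auto simp: N_def tr_def)
qed

text \<open>
  The two halves of the path of \<open>x\<close> around a cancelling pair of edges off the loop both escape from
  the loop and return to it.
\<close>
lemma normal_closure_deeper:
  assumes D: "2 * len g + 2 \<le> D"
    and x: "x \<in> normal_closure (F\<lparr>carrier := H\<rparr>) g" "x \<notin> generate F {g}"
  shows "2 * D \<le> len x + 2 * len g"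
proof -
  define P where "P = (\<lambda>e :: ('a set \<times> 'a) \<times> bool. fst e \<notin> loop_edges)"
  have xH: "x \<in> H" and trace: "free_reduce (filter P (path_edges H (word x))) = []"
    using normal_closure_trace_trivial[OF x(1)] by (simp_all add: P_def)
  note xF = H_carrier[OF xH]
  note wx = word_eval_word[OF xF]
  have "\<not> fst ` set (path_edges H (word x)) \<subseteq> loop_edges"
  proof
    assume "fst ` set (path_edges H (word x)) \<subseteq> loop_edges"
    then have "word_eval F (word x) \<otimes> inv (word_eval F (take 0 (word g))) \<in> generate F {g}"
      using wx xH by (intro path_in_loop_power[OF D]) (simp_all add: coset_H coset_mult_one H_subset)
    then show False using x(2) wx(3) xF by simp
  qed
  then have "filter P (path_edges H (word x)) \<noteq> []"
    by (simp add: P_def filter_empty_conv image_subset_iff)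
  then obtain es e es' where cancel: "filter P (path_edges H (word x)) = es @ e # flip e # es'"
    using trace free_reduce_reduced not_reduced_split by metis
  obtain \<alpha> l w where \<alpha>: "word x = \<alpha> @ l # w" "path_edges (H #> word_eval F \<alpha>) [l] = [e]" "P e"
    and rest: "filter P (path_edges (H #> word_eval F (\<alpha> @ [l])) w) = [] @ flip e # es'"
    using filter_path_edges_split[OF H_subset wx(1) cancel] by (metis append_Nil)
  define a where "a = word_eval F (\<alpha> @ [l])"
  define v where "v = H #> a"
  have over: "word_over \<alpha>" "word_over (\<alpha> @ [l])" "fst l \<in> S" "word_over w"
    using wx(1) unfolding \<alpha>(1) by auto
  have a: "a \<in> carrier F" using eval_closed[OF over(2)] by (simp only: a_def)
  have v: "v \<subseteq> carrier F" using r_coset_subset_G[OF H_subset a] by (simp only: v_def)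
  obtain \<gamma> k \<beta> where \<gamma>: "w = \<gamma> @ k # \<beta>" "filter P (path_edges v \<gamma>) = []"
      "path_edges (v #> word_eval F \<gamma>) [k] = [flip e]"
    using filter_path_edges_split[OF v over(4) rest[folded a_def, folded v_def]] by metis
  have over': "word_over \<gamma>" "word_over (k # \<beta>)" using over(4) unfolding \<gamma>(1) by auto
  have \<gamma>F: "word_eval F \<gamma> \<in> carrier F" using over'(1) by simp
  have k: "k = flip l"
    using \<alpha>(2) \<gamma>(3) by (auto simp: flip_def prod_eq_iff)
  have letters: "letter l \<in> carrier F" using letter_closed[OF over(3)] .
  have v_step: "v = (H #> word_eval F \<alpha>) #> letter l"
    using eval_append[OF over(1), of "[l]"] over(3) letters coset_mult_assoc[OF H_subset eval_closed[OF over(1)] letters]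
    by (simp add: v_def a_def)
  \<comment> \<open>The same edge is traversed before and after \<open>\<gamma>\<close>, in opposite directions.\<close>
  have closed: "v #> word_eval F \<gamma> = v"
  proof (cases "snd l")
    case True
    then have "(v #> word_eval F \<gamma>) #> letter k = H #> word_eval F \<alpha>"
      using \<alpha>(2) \<gamma>(3) k by (auto simp: flip_def)
    moreover have "(v #> word_eval F \<gamma>) #> letter k #> letter l = v #> word_eval F \<gamma>"
      using coset_step_flip[OF r_coset_subset_G[OF v \<gamma>F], of k] over(3) unfolding k by (simp only: flip_simps)
    ultimately show ?thesis using v_step by (simp only:)
  next
    case False
    then show ?thesis
      using \<alpha>(2) \<gamma>(3) k v_step by (auto simp: flip_def)
  qed
  \<comment> \<open>Otherwise \<open>l\<close> would be followed by its inverse.\<close>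
  have "\<gamma> \<noteq> []"
    using wx(2) k unfolding \<alpha>(1) \<gamma>(1) by (auto simp: reduced_append reduced_Cons)
  then obtain c \<gamma>' where c: "\<gamma> = c # \<gamma>'" by (cases \<gamma>) auto
  have "fst ` set (path_edges v [c]) \<subseteq> loop_edges"
    using \<gamma>(2) unfolding c by (auto simp: P_def split: if_splits)
  then obtain n where n: "v = H #> word_eval F (take n (word g))"
    using loop_edge_source[OF v, of c] over'(1) unfolding c by auto
  have first: "D \<le> length (\<alpha> @ [l]) + len g"
  proof (rule escaping_path_long[OF over(2)])
    show "reduced (\<alpha> @ [l])" using wx(2) unfolding \<alpha>(1) by (auto simp: reduced_append reduced_Cons)
    have "e \<in> set (path_edges H (\<alpha> @ [l]))"
      using \<alpha>(2) path_edges_append[OF H_subset over(1), of "[l]"] by (simp del: path_edges.simps)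
    then show "\<not> fst ` set (path_edges H (\<alpha> @ [l])) \<subseteq> loop_edges"
      using \<alpha>(3) unfolding P_def by blast
    show "H #> word_eval F (\<alpha> @ [l]) = H #> word_eval F (take n (word g))"
      using n by (simp only: v_def a_def)
  qed
  define b where "b = word_eval F (k # \<beta>)"
  have b: "b \<in> carrier F" using eval_closed[OF over'(2)] by (simp only: b_def)
  have "x = a \<otimes> (word_eval F \<gamma> \<otimes> b)"
    using wx(3) eval_append[OF over(2) over(4)] eval_append[OF over'] unfolding \<alpha>(1) \<gamma>(1)
    by (simp add: a_def b_def)
  then have "H = v #> b"
    using coset_H[OF xH] closed a b \<gamma>F coset_mult_assoc[OF H_subset a, of "word_eval F \<gamma> \<otimes> b"]
      coset_mult_assoc[OF v \<gamma>F b] by (simp only: v_def m_closed)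
  then have "H #> inv b = v"
    using coset_mult_assoc[OF v b inv_closed[OF b]] b v by (simp only: r_inv coset_mult_one)
  \<comment> \<open>The second half, read backwards, also starts at \<open>H\<close> and ends at \<open>v\<close>.\<close>
  have second: "D \<le> length (inverse_word (k # \<beta>)) + len g"
  proof (rule escaping_path_long)
    show "word_over (inverse_word (k # \<beta>))" using over'(2) by simp
    show "reduced (inverse_word (k # \<beta>))"
      using wx(2) unfolding \<alpha>(1) \<gamma>(1) by (intro reduced_inverse_word) (auto simp: reduced_append reduced_Cons)
    have "flip e \<in> set (path_edges v (k # \<beta>))"
      using \<gamma>(3) unfolding closed by simp
    then have "fst e \<in> fst ` set (path_edges H (inverse_word (k # \<beta>)))"
      using edges_inverse_word[OF v over'(2)] \<open>H = v #> b\<close> unfolding b_def by (metis flip_simps(1) imageI)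
    then show "\<not> fst ` set (path_edges H (inverse_word (k # \<beta>))) \<subseteq> loop_edges"
      using \<alpha>(3) unfolding P_def by blast
    show "H #> word_eval F (inverse_word (k # \<beta>)) = H #> word_eval F (take n (word g))"
      using eval_inverse_word[OF over'(2)] \<open>H #> inv b = v\<close> n by (simp only: b_def)
  qed
  have "len x = length \<alpha> + length \<gamma> + length \<beta> + 2"
    unfolding \<alpha>(1) \<gamma>(1) by simp
  with first second show ?thesis by (simp add: inverse_word_def)
qed

end

section \<open>Exponential growth\<close>

context free_group
begin

text \<open>The excess over \<open>2|g|\<close> doubles with every step, starting from \<open>2\<close>.\<close>
lemma subnormal_closure_growth:
  assumes g: "g \<in> carrier F"
    and base: "\<And>x. x \<in> subnormal_closure F g l \<Longrightarrow> x \<notin> generate F {g} \<Longrightarrow> 2 * len g + 2 \<le> len x"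
  shows "x \<in> subnormal_closure F g (l + j) \<Longrightarrow> x \<notin> generate F {g} \<Longrightarrow> 2 * len g + 2 * 2 ^ j \<le> len x"
proof (induction j arbitrary: x)
  case 0
  then show ?case using base by simp
next
  case (Suc j)
  interpret deep_subgroup F S "subnormal_closure F g (l + j)" g "2 * len g + 2 * 2 ^ j"
    using subnormal_closure_subgroup[OF g] Suc.IH
    by (intro deep_subgroup.intro free_group_axioms deep_subgroup_axioms.intro) auto
  have "2 * (2 * len g + 2 * 2 ^ j) \<le> len x + 2 * len g"
    using Suc.prems by (intro normal_closure_deeper) auto
  then show ?case by simp
qed

lemma subnormal_closure_exponential:
  assumes g: "g \<in> carrier F"
  obtains c :: real where "c > 0"
    "\<And>l x. x \<in> subnormal_closure F g l \<Longrightarrow> x \<notin> generate F {g} \<Longrightarrow> c * 2 ^ l \<le> real (len x)"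
proof -
  obtain l0 where l0: "\<And>l x. l0 \<le> l \<Longrightarrow> x \<in> subnormal_closure F g l \<Longrightarrow> len x \<le> 2 * len g + 1 \<Longrightarrow> x \<in> generate F {g}"
    using short_element_cyclic[OF g] by blast
  have base: "2 * len g + 2 \<le> len x" if "x \<in> subnormal_closure F g l0" "x \<notin> generate F {g}" for x
    using l0[OF order.refl that(1)] that(2) by linarith
  \<comment> \<open>The constant is \<open>2\<^bsup>-l\<^sub>0\<^esup>\<close>, as the growth only begins at level \<open>l\<^sub>0\<close>.\<close>
  have "1 / 2 ^ l0 * 2 ^ l \<le> real (len x)" if x: "x \<in> subnormal_closure F g l" "x \<notin> generate F {g}" for l x
  proof (cases "l0 \<le> l")
    case True
    then obtain j where j: "l = l0 + j" using le_Suc_ex by blast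
    have "2 * len g + 2 * 2 ^ j \<le> len x"
      by (rule subnormal_closure_growth[OF g, of l0]) (use base x j in auto)
    then have "2 ^ j \<le> len x" by simp
    then have "real (2 ^ j) \<le> real (len x)" by (simp only: of_nat_le_iff)
    then show ?thesis by (simp add: j power_add)
  next
    case False
    \<comment> \<open>Below the starting level the constant makes the bound at most \<open>1\<close>.\<close>
    have "x \<noteq> \<one>" using x(2) generate.one by metis
    moreover have "x \<in> carrier F"
      by (rule subgroup.mem_carrier[OF _ x(1)]) (use subnormal_closure_subgroup[OF g] in blast)
    ultimately have "word x \<noteq> []" using word_eval_word(3)[of x] by auto
    then have "1 \<le> real (len x)" by (cases "word x") auto
    moreover have "(2::real) ^ l \<le> 2 ^ l0" using False by (intro power_increasing) auto
    then have "1 / 2 ^ l0 * 2 ^ l \<le> (1::real)" by (simp add: field_simps)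
    ultimately show ?thesis by linarith
  qed
  then show ?thesis using that[of "1 / 2 ^ l0"] by simp
qed

text \<open>Going through the integer \<open>\<lceil>r\<rceil>\<close> covers the case of an empty set, where the infimum is \<open>\<infinity>\<close>.\<close>
lemma min_length_ge:
  assumes "\<And>x. x \<in> subnormal_closure F g l \<Longrightarrow> x \<notin> generate F {g} \<Longrightarrow> r \<le> real (len x)"
  shows "ereal r \<le> ereal_of_enat (min_length F S g l)"
proof -
  have "enat (nat \<lceil>r\<rceil>) \<le> min_length F S g l"
    unfolding min_length_def
  proof (rule INF_greatest)
    fix x assume "x \<in> subnormal_closure F g l - generate F {g}"
    then have "r \<le> real (len x)" using assms by blast
    then show "enat (nat \<lceil>r\<rceil>) \<le> enat (word_length F S x)"
      by (simp add: word_length_def word_def nat_le_iff ceiling_le_iff)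
  qed
  then have "ereal_of_enat (enat (nat \<lceil>r\<rceil>)) \<le> ereal_of_enat (min_length F S g l)"
    by (simp only: ereal_of_enat_le_iff)
  moreover have "ereal r \<le> ereal_of_enat (enat (nat \<lceil>r\<rceil>))"
    by (simp add: real_nat_ceiling_ge)
  ultimately show ?thesis by (rule order.trans[rotated])
qed

end

theorem theorem1p4:
  fixes F :: "('a, 'b) monoid_scheme" and S :: "'a set" and g :: 'a
  assumes "group F" and "free_basis F S" and "g \<in> carrier F"
  shows "(\<Inter>l\<in>{1..}. subnormal_closure F g l) = generate F {g} \<and>
         (\<exists>c::real. c > 0 \<and> (\<forall>l\<ge>1. ereal (c * 2 ^ l) \<le> ereal_of_enat (min_length F S g l)))"
proof -
  interpret free_group F S
    using assms(1,2) by (simp add: free_group_def free_group_axioms_def)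
  obtain c :: real where c: "c > 0"
    and growth: "\<And>l x. x \<in> subnormal_closure F g l \<Longrightarrow> x \<notin> generate F {g} \<Longrightarrow> c * 2 ^ l \<le> real (len x)"
    using subnormal_closure_exponential[OF assms(3)] by blast
  have "generate F {g} \<subseteq> subnormal_closure F g l" for l
    using subnormal_closure_subgroup[OF assms(3), of l] by (intro generate_subgroup_incl) auto
  moreover have "x \<in> generate F {g}" if x: "x \<in> (\<Inter>l\<in>{1..}. subnormal_closure F g l)" for x
  proof (rule ccontr)
    assume "x \<notin> generate F {g}"
    obtain l where l: "real (len x) / c < 2 ^ l"
      using real_arch_pow[of 2] by auto
    moreover have "(2::real) ^ l \<le> 2 ^ Suc l" by simp
    ultimately have "real (len x) / c < 2 ^ Suc l" by linarith
    then have "real (len x) < c * 2 ^ Suc l"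
      using c by (simp only: pos_divide_less_eq mult.commute)
    \<comment> \<open>The intersection starts at level \<open>1\<close>, so \<open>Suc l\<close> is used in case \<open>l = 0\<close>.\<close>
    moreover have "x \<in> subnormal_closure F g (Suc l)"
      using x[unfolded INT_iff] by (rule bspec) simp
    then have "c * 2 ^ Suc l \<le> real (len x)"
      using \<open>x \<notin> generate F {g}\<close> by (rule growth)
    ultimately show False by linarith
  qed
  moreover have "ereal (c * 2 ^ l) \<le> ereal_of_enat (min_length F S g l)" for l
    by (rule min_length_ge) (rule growth)
  ultimately show ?thesis using c by blast
qed

end
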